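(* Let $d\ge 1$. There exists $\varepsilon_0\in(0,1)$ such that for every $\varepsilon\in\mathbf{R}$ with $|\varepsilon|\le \varepsilon_0$ the Gaussian field distribution $\mu_\varepsilon$ on $\mathbf{R}^{\mathbf{Z}^d}$ satisfies: 1. $\mu_\varepsilon$ is a factor of an i.i.d. process. 2. There exists $c>0$ such that for all $l\in\mathbf{N}$ there exists an $l$-dependent distribution $\nu_l$ on $\mathbf{R}^{\mathbf{Z}^d}$ such that for every finite subset $\Lambda\subset\mathbf{Z}^d$, $$d_{\mathrm{TV}}(\mu_\varepsilon|_\Lambda,\nu_l|_\Lambda)\le |\Lambda|\,e^{-cl}.$$
   Context: For $\varepsilon\in(-1,1)$, $\mu_\varepsilon$ denotes the law of the centered Gaussian field $(X_i)_{i\in\mathbf{Z}^d}$ with covariance $\operatorname{Cov}(X_i,X_j)=\sum_{n\ge 0}\left(\frac{\varepsilon}{2d}\right)^n N_n(i,j)$, where $N_n(i,j)$ is the number of nearest-neighbour paths of length $n$ from $i$ to $j$ in $\mathbf{Z}^d$. Equivalently, it is the centered stationary Gaussian field such that for every $i\in\mathbf{Z}^d$ and $\mu_\varepsilon$-a.e. $\xi\in\mathbf{R}^{\mathbf{Z}^d}$, $\mu_\varepsilon(X_i\in\cdot\mid (X_j)_{j\ne i})(\xi)=\mathcal{N}\big(\frac{\varepsilon}{2d}\sum_{j:\|j-i\|_1=1}\xi_j,\,1\big)$. A translation-invariant probability measure $\mu$ on $S^{\mathbf{Z}^d}$ is a factor of an i.i.d. process (FIID) if there exist a probability space $(\mathcal{Y},\mathcal{F},\nu)$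 and a measurable map $F:\mathcal{Y}^{\mathbf{Z}^d}\to S^{\mathbf{Z}^d}$ commuting with all translations of $\mathbf{Z}^d$ such that $\mu$ is the image of $\nu^{\otimes\mathbf{Z}^d}$ by $F$. A probability measure on $S^{\mathbf{Z}^d}$ is $l$-dependent if, when $X$ has this law, for all $A,A'\subset\mathbf{Z}^d$ at distance (for $\|\cdot\|_1$) greater than $l$, the restrictions $X|_A$ and $X|_{A'}$ are independent. $\mu|_\Lambda$ denotes the law of $X|_\Lambda=(X_i)_{i\in\Lambda}$ when $X\sim\mu$. $d_{\mathrm{TV}}(\mu,\nu)=\sup_A|\mu(A)-\nu(A)|$ over measurable events $A$. *)

theory Defs
  imports "HOL-Probability.Probability"
begin

text \<open>The lattice \<open>\<int>\<^sup>d\<close> is the type \<^typ>\<open>int ^ 'd\<close> with \<open>d = CARD('d)\<close>; since types are nonempty,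
  \<open>d \<ge> 1\<close> holds automatically.\<close>

definition l1_dist :: "int ^ 'd \<Rightarrow> int ^ 'd \<Rightarrow> int" where
  "l1_dist i j = (\<Sum>k\<in>UNIV. \<bar>i $ k - j $ k\<bar>)"

text \<open>A path of length \<open>n\<close> (\<open>n\<close> steps) is given by the list of the \<open>n + 1\<close> sites it visits.\<close>

definition nn_paths :: "nat \<Rightarrow> int ^ 'd \<Rightarrow> int ^ 'd \<Rightarrow> (int ^ 'd) list set" where
  "nn_paths n i j = {p. length p = Suc n \<and> hd p = i \<and> last p = j \<and>
                        (\<forall>k<n. l1_dist (p ! k) (p ! Suc k) = 1)}"

definition field_cov :: "real \<Rightarrow> int ^ 'd \<Rightarrow> int ^ 'd \<Rightarrow> real" where
  "field_cov \<epsilon> i j = (\<Sum>n. (\<epsilon> / (2 * real CARD('d))) ^ n * real (card (nn_paths n i j)))"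

abbreviation config_space :: "(int ^ 'd) set \<Rightarrow> (int ^ 'd \<Rightarrow> real) measure" where
  "config_space A \<equiv> PiM A (\<lambda>_. borel)"

text \<open>Normal laws are allowed to be degenerate: for \<open>\<sigma> = 0\<close> the law is the Dirac mass at \<open>0\<close>
  (whereas \<^term>\<open>normal_density 0 0\<close> is identically \<open>0\<close>).\<close>

definition centered_normal :: "real \<Rightarrow> real measure" where
  "centered_normal \<sigma> =
     (if \<sigma> = 0 then return borel 0 else density lborel (\<lambda>x. ennreal (normal_density 0 \<sigma> x)))"

definition centered_gaussian_process :: "'a measure \<Rightarrow> ('i \<Rightarrow> 'a \<Rightarrow> real) \<Rightarrow> bool" where
  "centered_gaussian_process M X \<longleftrightarrow>
     prob_space M \<and> (\<forall>i. X i \<in> borel_measurable M) \<and>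
     (\<forall>J a. finite J \<longrightarrow>
        (\<exists>\<sigma>\<ge>0. distr M borel (\<lambda>\<omega>. \<Sum>i\<in>J. a i * X i \<omega>) = centered_normal \<sigma>))"

definition covariance :: "'a measure \<Rightarrow> ('a \<Rightarrow> real) \<Rightarrow> ('a \<Rightarrow> real) \<Rightarrow> real" where
  "covariance M Y Z =
     (\<integral>\<omega>. (Y \<omega> - (\<integral>\<omega>'. Y \<omega>' \<partial>M)) * (Z \<omega> - (\<integral>\<omega>'. Z \<omega>' \<partial>M)) \<partial>M)"

text \<open>The law \<open>\<mu>\<^sub>\<epsilon>\<close>. It exists and is unique for \<open>\<bar>\<epsilon>\<bar> < 1\<close>, so that the definite description is
  meaningful; outside this range the definition carries no information.\<close>

definition gaussian_field :: "real \<Rightarrow> (int ^ 'd \<Rightarrow> real) measure" where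
  "gaussian_field \<epsilon> = (THE \<mu>. sets \<mu> = sets (config_space UNIV) \<and>
     centered_gaussian_process \<mu> (\<lambda>i \<xi>. \<xi> i) \<and>
     (\<forall>i j. covariance \<mu> (\<lambda>\<xi>. \<xi> i) (\<lambda>\<xi>. \<xi> j) = field_cov \<epsilon> i j))"

definition translate :: "int ^ 'd \<Rightarrow> (int ^ 'd \<Rightarrow> 'a) \<Rightarrow> (int ^ 'd \<Rightarrow> 'a)" where
  "translate a \<xi> = (\<lambda>i. \<xi> (i + a))"

definition translation_invariant :: "(int ^ 'd \<Rightarrow> real) measure \<Rightarrow> bool" where
  "translation_invariant \<mu> \<longleftrightarrow> (\<forall>a. distr \<mu> (config_space UNIV) (translate a) = \<mu>)"

definition equivariant_factor ::
    "'y measure \<Rightarrow> ((int ^ 'd \<Rightarrow> 'y) \<Rightarrow> (int ^ 'd \<Rightarrow> real)) \<Rightarrow> (int ^ 'd \<Rightarrow> real) measure \<Rightarrow> bool" where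
  "equivariant_factor N F \<mu> \<longleftrightarrow>
     prob_space N \<and>
     F \<in> measurable (PiM UNIV (\<lambda>_. N)) (config_space UNIV) \<and>
     (\<forall>a. \<forall>y\<in>space (PiM UNIV (\<lambda>_. N)). F (translate a y) = translate a (F y)) \<and>
     \<mu> = distr (PiM UNIV (\<lambda>_. N)) (config_space UNIV) F"

text \<open>HOL cannot quantify existentially over the type carrying the source space. The source space
  below is an arbitrary probability space (with an arbitrary sigma-algebra) carried by reals; lemma
  \<open>factor_of_iid_any_type\<close> shows that spaces of other types give no further factors.\<close>

definition factor_of_iid :: "(int ^ 'd \<Rightarrow> real) measure \<Rightarrow> bool" where
  "factor_of_iid \<mu> \<longleftrightarrow>
     prob_space \<mu> \<and> sets \<mu> = sets (config_space UNIV) \<and> translation_invariant \<mu> \<and>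
     (\<exists>(N :: real measure) F. equivariant_factor N F \<mu>)"

definition restrict_law ::
    "(int ^ 'd) set \<Rightarrow> (int ^ 'd \<Rightarrow> real) measure \<Rightarrow> (int ^ 'd \<Rightarrow> real) measure" where
  "restrict_law \<Lambda> \<mu> = distr \<mu> (config_space \<Lambda>) (\<lambda>\<xi>. restrict \<xi> \<Lambda>)"

definition l_dependent :: "nat \<Rightarrow> (int ^ 'd \<Rightarrow> real) measure \<Rightarrow> bool" where
  "l_dependent l \<nu> \<longleftrightarrow>
     prob_space \<nu> \<and> sets \<nu> = sets (config_space UNIV) \<and>
     (\<forall>A A'. (\<forall>i\<in>A. \<forall>j\<in>A'. l1_dist i j > int l) \<longrightarrow>
        prob_space.indep_var \<nu> (config_space A) (\<lambda>\<xi>. restrict \<xi> A)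
                               (config_space A') (\<lambda>\<xi>. restrict \<xi> A'))"

text \<open>Meant for two probability measures with the same sigma-algebra.\<close>

definition tv_dist :: "'a measure \<Rightarrow> 'a measure \<Rightarrow> real" where
  "tv_dist M N = (SUP A\<in>sets M. \<bar>measure M A - measure N A\<bar>)"

lemma distr_PiM_translate:
  fixes N :: "'y measure" and a :: "int ^ 'd"
  assumes "prob_space N"
  shows "distr (PiM UNIV (\<lambda>_. N)) (PiM UNIV (\<lambda>_. N)) (translate a) = PiM UNIV (\<lambda>_. N)"
  using distr_PiM_reindex[where K = UNIV and I = UNIV and M = "\<lambda>_. N" and f = "\<lambda>i. i + a"] assms
  by (simp add: translate_def[abs_def] restrict_def)

lemma measurable_translate:
  "translate a \<in> measurable (PiM UNIV (\<lambda>_. N)) (PiM UNIV (\<lambda>_. N))"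
  unfolding translate_def[abs_def]
  by (rule measurable_PiM_single') (auto simp: space_PiM PiE_def Pi_def)

lemma PiM_set_countable_base:
  fixes N :: "'y measure"
  assumes "A \<in> sets (PiM (UNIV :: 'i set) (\<lambda>_. N))"
  shows "\<exists>E. range E \<subseteq> sets N \<and>
    A \<in> sigma_sets (UNIV \<rightarrow>\<^sub>E space N) {{\<omega> \<in> UNIV \<rightarrow>\<^sub>E space N. \<omega> i \<in> E n} | i (n::nat). True}"
  using assms unfolding sets_PiM_single
proof (induction rule: sigma_sets.induct)
  case (Basic A)
  then obtain i B where "A = {\<omega> \<in> UNIV \<rightarrow>\<^sub>E space N. \<omega> i \<in> B}" "B \<in> sets N" by auto
  then show ?case by (intro exI[of _ "\<lambda>_. B"]) (auto intro!: sigma_sets.Basic)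
next
  case Empty
  show ?case by (intro exI[of _ "\<lambda>_. {}"]) (auto intro: sigma_sets.Empty)
next
  case (Compl A)
  then show ?case by (blast intro: sigma_sets.Compl)
next
  case (Union A)
  have "\<exists>E. \<forall>k. range (E k) \<subseteq> sets N \<and> A k \<in> sigma_sets (UNIV \<rightarrow>\<^sub>E space N)
       {{\<omega> \<in> UNIV \<rightarrow>\<^sub>E space N. \<omega> i \<in> E k n} | i (n::nat). True}"
    using Union.IH by (intro choice allI)
  then obtain E where E: "\<And>k. range (E k) \<subseteq> sets N"
    "\<And>k. A k \<in> sigma_sets (UNIV \<rightarrow>\<^sub>E space N)
       {{\<omega> \<in> UNIV \<rightarrow>\<^sub>E space N. \<omega> i \<in> E k n} | i (n::nat). True}" by auto
  define E' where "E' m = case_prod E (prod_decode m)" for m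
  have E': "E k n = E' (prod_encode (k, n))" for k n by (simp add: E'_def)
  have "A k \<in> sigma_sets (UNIV \<rightarrow>\<^sub>E space N)
       {{\<omega> \<in> UNIV \<rightarrow>\<^sub>E space N. \<omega> i \<in> E' n} | i (n::nat). True}" for k
    using E(2)[of k] by (rule sigma_sets_mono'[THEN subsetD, rotated]) (use E' in blast)
  moreover have "range E' \<subseteq> sets N"
    using E(1) by (auto simp: E'_def split: prod.split)
  ultimately show ?case by (blast intro: sigma_sets.Union)
qed

lemma factor_of_iid_any_type:
  fixes N :: "'y measure" and F :: "(int ^ 'd \<Rightarrow> 'y) \<Rightarrow> (int ^ 'd \<Rightarrow> real)"
  assumes F: "equivariant_factor N F \<mu>"
  shows "factor_of_iid \<mu>"
proof -
  let ?P = "PiM UNIV (\<lambda>_ :: int ^ 'd. N)"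
  note tr = measurable_translate
  have N: "prob_space N" and mF [measurable]: "F \<in> measurable ?P (config_space UNIV)"
    and eq: "\<And>a y. y \<in> space ?P \<Longrightarrow> F (translate a y) = translate a (F y)"
    and \<mu>: "\<mu> = distr ?P (config_space UNIV) F"
    using F by (auto simp: equivariant_factor_def)
  interpret N: prob_space N by fact
  interpret P: prob_space ?P by (intro prob_space_PiM N)
  have spP: "space ?P = (UNIV \<rightarrow>\<^sub>E space N)" by (simp add: space_PiM)
  have inv: "translation_invariant \<mu>"
    unfolding translation_invariant_def
  proof
    fix a
    have "distr \<mu> (config_space UNIV) (translate a) = distr ?P (config_space UNIV) (translate a \<circ> F)"
      unfolding \<mu> by (intro distr_distr tr mF)
    also have "\<dots> = distr ?P (config_space UNIV) (F \<circ> translate a)"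
      by (intro distr_cong) (auto simp: eq)
    also have "\<dots> = distr (distr ?P ?P (translate a)) (config_space UNIV) F"
      by (intro distr_distr[symmetric] tr mF)
    also have "\<dots> = \<mu>" by (simp add: distr_PiM_translate N \<mu>)
    finally show "distr \<mu> (config_space UNIV) (translate a) = \<mu>" .
  qed

  define F0 where "F0 \<omega> = F \<omega> 0" for \<omega>
  have [measurable]: "F0 \<in> borel_measurable ?P" unfolding F0_def by measurable
  have "{\<omega> \<in> space ?P. F0 \<omega> < of_rat q} \<in> sets ?P" for q by measurable
  then have "\<exists>E0. \<forall>q. range (E0 q) \<subseteq> sets N \<and> {\<omega> \<in> space ?P. F0 \<omega> < of_rat q} \<in> sigma_sets (UNIV \<rightarrow>\<^sub>E space N)
       {{\<omega> \<in> UNIV \<rightarrow>\<^sub>E space N. \<omega> i \<in> E0 q n} | (i :: int ^ 'd) (n::nat). True}"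
    by (intro choice allI PiM_set_countable_base)
  then obtain E0 where E0: "\<And>q. range (E0 q) \<subseteq> sets N"
    "\<And>q. {\<omega> \<in> space ?P. F0 \<omega> < of_rat q} \<in> sigma_sets (UNIV \<rightarrow>\<^sub>E space N)
       {{\<omega> \<in> UNIV \<rightarrow>\<^sub>E space N. \<omega> i \<in> E0 q n} | (i :: int ^ 'd) (n::nat). True}" by auto
  define E where "E m = (case prod_decode m of (k, n) \<Rightarrow> E0 (from_nat k) n)" for m
  have E: "E0 q n = E (prod_encode (to_nat q, n))" for q n by (simp add: E_def)
  have E_sets: "E n \<in> sets N" for n
    using E0(1) by (auto simp: E_def split: prod.split)
  have gen: "{\<omega> \<in> space ?P. F0 \<omega> < of_rat q} \<in> sigma_sets (UNIV \<rightarrow>\<^sub>E space N)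
       {{\<omega> \<in> UNIV \<rightarrow>\<^sub>E space N. \<omega> i \<in> E n} | (i :: int ^ 'd) (n::nat). True}" for q
    using E0(2)[of q] by (rule sigma_sets_mono'[THEN subsetD, rotated]) (use E in blast)

  obtain c :: "nat set \<Rightarrow> real" where c: "bij c"
    using nat_sets_eqpoll_reals unfolding eqpoll_def by blast
  define D where "D n = {x. n \<in> inv c x}" for n
  define R where "R = sigma UNIV (range D)"
  define h where "h y = c {n. y \<in> E n}" for y
  have hD: "h y \<in> D n \<longleftrightarrow> y \<in> E n" for y n
    using c by (simp add: h_def D_def bij_is_inj inv_f_f)
  have spR [simp]: "space R = UNIV" by (simp add: R_def)
  have D_sets [measurable]: "D n \<in> sets R" for n by (simp add: R_def)
  have h [measurable]: "h \<in> measurable N R"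
    unfolding R_def
  proof (rule measurable_sigma_sets)
    fix A assume "A \<in> range D"
    then obtain n where "A = D n" by auto
    then have "h -` A \<inter> space N = E n"
      using hD sets.sets_into_space[OF E_sets[of n]] by auto
    then show "h -` A \<inter> space N \<in> sets N" using E_sets by simp
  qed auto
  define N' where "N' = distr N R h"
  have N': "prob_space N'" unfolding N'_def by (rule N.prob_space_distr[OF h])
  let ?P' = "PiM UNIV (\<lambda>_ :: int ^ 'd. N')"
  have sets_N': "sets N' = sets R" and spN' [simp]: "space N' = UNIV" by (simp_all add: N'_def)
  have h' [measurable]: "h \<in> measurable N N'" using h sets_N' by (simp cong: measurable_cong_sets)
  define H where "H \<omega> = (\<lambda>i :: int ^ 'd. h (\<omega> i))" for \<omega>
  have H [measurable]: "H \<in> measurable ?P ?P'"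
    unfolding H_def[abs_def] by (rule measurable_PiM_single') (auto simp: space_PiM)

  have "distr ?P ?P' H = ?P'"
  proof -
    interpret Q: product_prob_space "\<lambda>_ :: int ^ 'd. N" UNIV
      using N by (intro product_prob_spaceI)
    interpret Q': product_prob_space "\<lambda>_ :: int ^ 'd. N'" UNIV
      using N' by (intro product_prob_spaceI)
    show ?thesis
    proof (rule Q'.PiM_eq[symmetric, THEN sym])
      fix J :: "(int ^ 'd) set" and A assume J: "finite J" "J \<subseteq> UNIV" "\<And>j. j \<in> J \<Longrightarrow> A j \<in> sets N'"
      have "emeasure (distr ?P ?P' H) (prod_emb UNIV (\<lambda>_. N') J (Pi\<^sub>E J A)) =
        emeasure ?P (H -` prod_emb UNIV (\<lambda>_. N') J (Pi\<^sub>E J A) \<inter> space ?P)"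
        using J by (intro emeasure_distr H sets_PiM_I) auto
      also have "H -` prod_emb UNIV (\<lambda>_. N') J (Pi\<^sub>E J A) \<inter> space ?P =
         prod_emb UNIV (\<lambda>_. N) J (Pi\<^sub>E J (\<lambda>j. h -` A j \<inter> space N))"
        by (auto simp: prod_emb_def space_PiM H_def PiE_iff)
      also have "emeasure ?P \<dots> = (\<Prod>j\<in>J. emeasure N (h -` A j \<inter> space N))"
        using J by (intro Q.emeasure_PiM_emb) (auto intro!: measurable_sets[OF h'])
      also have "\<dots> = (\<Prod>j\<in>J. emeasure N' (A j))"
        using J(3) sets_N' unfolding N'_def by (intro prod.cong refl emeasure_distr[symmetric] h) auto
      finally show "emeasure (distr ?P ?P' H) (prod_emb UNIV (\<lambda>_. N') J (Pi\<^sub>E J A)) =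
        (\<Prod>j\<in>J. emeasure N' (A j))" .
    qed simp
  qed
  note distr_H = this

  have "\<exists>B\<in>sets ?P'. {\<omega> \<in> space ?P. F0 \<omega> < of_rat q} = H -` B \<inter> space ?P" for q
  proof -
    let ?V = "vimage_algebra (space ?P) H ?P'"
    have V: "sets ?V = {H -` B \<inter> space ?P | B. B \<in> sets ?P'}"
      by (rule sets_vimage_algebra2) (simp add: space_PiM)
    have "{{\<omega> \<in> UNIV \<rightarrow>\<^sub>E space N. \<omega> i \<in> E n} | (i :: int ^ 'd) (n::nat). True} \<subseteq> sets ?V"
    proof clarify
      fix i :: "int ^ 'd" and n :: nat
      have "{z \<in> space ?P'. z i \<in> D n} \<in> sets ?P'"
        using D_sets[of n] sets_N' by (intro sets_Collect_single') (auto simp: Int_def)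
      moreover have "{\<omega> \<in> UNIV \<rightarrow>\<^sub>E space N. \<omega> i \<in> E n} = H -` {z \<in> space ?P'. z i \<in> D n} \<inter> space ?P"
        by (auto simp: spP H_def hD space_PiM)
      ultimately show "{\<omega> \<in> UNIV \<rightarrow>\<^sub>E space N. \<omega> i \<in> E n} \<in> sets ?V" unfolding V by blast
    qed
    then have "sigma_sets (UNIV \<rightarrow>\<^sub>E space N)
       {{\<omega> \<in> UNIV \<rightarrow>\<^sub>E space N. \<omega> i \<in> E n} | (i :: int ^ 'd) (n::nat). True} \<subseteq> sets ?V"
      using sets.sigma_sets_subset[of _ ?V] by (simp add: spP)
    then have "{\<omega> \<in> space ?P. F0 \<omega> < of_rat q} \<in> sets ?V" using gen[of q] by (rule subsetD)
    then show ?thesis unfolding V by blast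
  qed
  then have "\<exists>B. \<forall>q. B q \<in> sets ?P' \<and> {\<omega> \<in> space ?P. F0 \<omega> < of_rat q} = H -` B q \<inter> space ?P"
    unfolding Bex_def by (intro choice allI)
  then obtain B where B [measurable]: "\<And>q. B q \<in> sets ?P'"
    and BF: "\<And>q. {\<omega> \<in> space ?P. F0 \<omega> < of_rat q} = H -` B q \<inter> space ?P" by blast
  define f where "f z = real_of_ereal (INF q. if z \<in> B q then ereal (of_rat q) else \<infinity>)" for z
  have f [measurable]: "f \<in> borel_measurable ?P'" unfolding f_def by measurable
  have fH: "f (H \<omega>) = F0 \<omega>" if \<omega>: "\<omega> \<in> space ?P" for \<omega>
  proof -
    have "H \<omega> \<in> B q \<longleftrightarrow> F0 \<omega> < of_rat q" for q using BF[of q] \<omega> by auto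
    moreover have "(INF q. if F0 \<omega> < of_rat q then ereal (of_rat q) else \<infinity>) = ereal (F0 \<omega>)"
    proof (rule INF_eqI)
      fix y assume y: "\<And>q. q \<in> UNIV \<Longrightarrow> y \<le> (if F0 \<omega> < of_rat q then ereal (of_rat q) else \<infinity>)"
      show "y \<le> ereal (F0 \<omega>)"
      proof (rule ccontr)
        assume "\<not> y \<le> ereal (F0 \<omega>)"
        then obtain x where x: "ereal (F0 \<omega>) < ereal x" "ereal x < y"
          using ereal_dense2[of "ereal (F0 \<omega>)" y] by (auto simp: not_le)
        then obtain q where "F0 \<omega> < of_rat q" "of_rat q < x"
          using of_rat_dense[of "F0 \<omega>" x] by auto
        then have "y \<le> ereal (of_rat q)" "ereal (of_rat q) < ereal x" using y[of q] by auto
        then show False using x(2) by (meson leD order.strict_trans order.trans)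
      qed
    qed auto
    ultimately show ?thesis by (simp add: f_def)
  qed

  define F' where "F' z = (\<lambda>i. f (translate i z))" for z
  have F' [measurable]: "F' \<in> measurable ?P' (config_space UNIV)"
    unfolding F'_def[abs_def]
    by (rule measurable_PiM_single') (auto intro!: measurable_compose[OF tr f])
  have FF': "F \<omega> = F' (H \<omega>)" if \<omega>: "\<omega> \<in> space ?P" for \<omega>
  proof
    fix i
    have "translate i (H \<omega>) = H (translate i \<omega>)" by (simp add: translate_def H_def)
    moreover have "translate i \<omega> \<in> space ?P" using measurable_space[OF tr \<omega>] .
    ultimately have "F' (H \<omega>) i = F (translate i \<omega>) 0" by (simp add: F'_def fH F0_def)
    also have "\<dots> = F \<omega> i" by (simp add: eq[OF \<omega>]) (simp add: translate_def)
    finally show "F \<omega> i = F' (H \<omega>) i" ..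
  qed
  have "\<mu> = distr ?P (config_space UNIV) (F' \<circ> H)"
    unfolding \<mu> by (intro distr_cong) (auto simp: FF')
  also have "\<dots> = distr (distr ?P ?P' H) (config_space UNIV) F'"
    by (intro distr_distr[symmetric] H F')
  finally have "\<mu> = distr ?P' (config_space UNIV) F'" by (simp add: distr_H)
  moreover have "F' (translate a z) = translate a (F' z)" for a z
    by (simp add: F'_def translate_def add_ac)
  ultimately have "equivariant_factor N' F' \<mu>"
    using N' F' by (auto simp: equivariant_factor_def)
  moreover have "prob_space \<mu>" unfolding \<mu> by (rule P.prob_space_distr[OF mF])
  moreover have "sets \<mu> = sets (config_space UNIV)" by (simp add: \<mu>)
  ultimately show ?thesis using inv unfolding factor_of_iid_def by blast
qed

end

theory Submission
  imports Defs
begin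

text \<open>Write \<open>\<theta> = \<epsilon> / (2 * d)\<close> and let \<open>T\<close> be the nearest-neighbour sum operator on functions on the lattice,
  so that the covariance of the field is the kernel of \<open>\<Sum>n. \<theta> ^ n * T ^ n\<close>. The power series identity

  \<open>\<Sum>n. x ^ n = 1/2 + (\<Sum>m. (x ^ m * (1 + x)) ^ 2) / 2\<close>

  writes it as a sum of squares of operators. Hence, if \<open>Z, W 0, W 1, \<dots>\<close> are independent white noises,
  the field \<open>X = (Z + Y) / sqrt 2\<close> with \<open>Y = (\<Sum>m. (\<theta> * T) ^ m * (1 + \<theta> * T) applied to W m)\<close> has
  exactly the required Gaussian law. Everything follows from this explicit formula.

  Factor of an i.i.d. process: the noises attached to one site form one i.i.d. symbol, and \<open>X\<close> is
  computed from them by a translation-equivariant series.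

  Approximation: stopping the series after \<open>q\<close> terms gives a field whose value at \<open>i\<close> reads noise
  within distance \<open>q\<close> only, hence a \<open>2 * q\<close>-dependent field. It differs from \<open>X\<close> in the part \<open>Y\<close> alone.
  Given all the \<open>W m\<close>, the values \<open>X i\<close> are independent normal variables whose variance \<open>1/2\<close> comes
  from \<open>Z\<close>, and moving the mean of a normal variable changes its law by an amount at most proportional to
  the displacement. Exchanging the sites of \<open>\<Lambda>\<close> one after the other bounds the total variation distance
  by a constant times the sum over \<open>\<Lambda>\<close> of the expected truncation errors
  (\<open>replace_shift_tv\<close>), and these decay like \<open>r ^ q\<close>, where \<open>r\<close> is \<open>\<bar>\<theta>\<bar>\<close> times the number of
  neighbours of a site (\<open>full_field_tail_le\<close>). It is the independent noise \<open>Z\<close> that converts an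
  approximation of the values into an approximation of the law.

  Since the field is defined by a definite description, its law must also be shown to be unique.
  A law on a product of real lines is determined by the characteristic functions of
  all finite linear combinations of the coordinates (\<open>measure_eqI_linear_combination_char\<close>);
  this reduces to the one-dimensional uniqueness theorem, applied to one coordinate at a time.\<close>

section \<open>Jointly Gaussian families\<close>

lemma prob_space_std_normal: "prob_space std_normal_distribution"
  by (rule prob_space_normal_density) simp

lemma distr_affine_std_normal:
  assumes "0 < \<sigma>"
  shows "distr std_normal_distribution borel (\<lambda>x. a + \<sigma> * x) = density lborel (normal_density a \<sigma>)"
proof -
  interpret prob_space std_normal_distribution by (rule prob_space_std_normal)
  have "distributed std_normal_distribution lborel (\<lambda>x. x) std_normal_density"
    by (auto simp: distributed_def distr_id2 sets_density)
  from normal_density_affine[OF this, of \<sigma> a] assms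
  have "distr std_normal_distribution lborel (\<lambda>x. a + \<sigma> * x) = density lborel (normal_density a \<sigma>)"
    by (simp add: distributed_def)
  moreover have "distr std_normal_distribution lborel (\<lambda>x. a + \<sigma> * x) =
      distr std_normal_distribution borel (\<lambda>x. a + \<sigma> * x)"
    by (rule distr_cong) auto
  ultimately show ?thesis by simp
qed

text \<open>Scaling the standard normal law gives the degenerate case \<open>\<sigma> = 0\<close> as well, so that moments and
  characteristic functions need no case distinction.\<close>

lemma centered_normal_eq_distr:
  assumes "0 \<le> \<sigma>"
  shows "centered_normal \<sigma> = distr std_normal_distribution borel (\<lambda>x. \<sigma> * x)"
proof (cases "\<sigma> = 0")
  case True
  interpret prob_space std_normal_distribution by (rule prob_space_std_normal)
  have "distr std_normal_distribution borel (\<lambda>x. 0 :: real) = return borel 0"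
    by (rule distr_const) simp
  then show ?thesis
    using True by (simp add: centered_normal_def)
next
  case False
  then show ?thesis
    using distr_affine_std_normal[of \<sigma> 0] assms by (simp add: centered_normal_def)
qed

lemma real_distribution_centered_normal:
  assumes "0 \<le> \<sigma>"
  shows "real_distribution (centered_normal \<sigma>)"
proof -
  interpret prob_space std_normal_distribution by (rule prob_space_std_normal)
  show ?thesis
    unfolding centered_normal_eq_distr[OF assms] by (rule real_distribution_distr) simp
qed

lemma char_centered_normal:
  assumes "0 \<le> \<sigma>"
  shows "char (centered_normal \<sigma>) t = of_real (exp (- (\<sigma>\<^sup>2 * t\<^sup>2) / 2))"
proof -
  have "char (centered_normal \<sigma>) t = char std_normal_distribution (\<sigma> * t)"
    unfolding char_def centered_normal_eq_distr[OF assms]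
    by (subst integral_distr) (auto simp: mult_ac)
  then show ?thesis by (simp add: char_std_normal_distribution power_mult_distrib)
qed

lemma
  assumes "0 \<le> \<sigma>"
  shows integrable_centered_normal_moment: "integrable (centered_normal \<sigma>) (\<lambda>x. x ^ k)"
    and integral_centered_normal: "(\<integral>x. x \<partial>centered_normal \<sigma>) = 0"
    and integral_centered_normal_square: "(\<integral>x. x\<^sup>2 \<partial>centered_normal \<sigma>) = \<sigma>\<^sup>2"
proof -
  have "integrable std_normal_distribution (\<lambda>x. \<sigma> ^ k * x ^ k)"
    by (intro integrable_mult_right integrable_std_normal_distribution_moment)
  then show "integrable (centered_normal \<sigma>) (\<lambda>x. x ^ k)"
    unfolding centered_normal_eq_distr[OF assms]
    by (subst integrable_distr_eq) (auto simp: power_mult_distrib)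
  show "(\<integral>x. x \<partial>centered_normal \<sigma>) = 0"
    unfolding centered_normal_eq_distr[OF assms]
    using integral_std_normal_distribution_moment_odd[of 1]
    by (subst integral_distr) auto
  show "(\<integral>x. x\<^sup>2 \<partial>centered_normal \<sigma>) = \<sigma>\<^sup>2"
    unfolding centered_normal_eq_distr[OF assms]
    using std_normal_distribution_even_moments(1)[of 1]
    by (subst integral_distr) (auto simp: power_mult_distrib)
qed

text \<open>Prescribing the joint characteristic function at every finite linear combination makes this notion
  visibly stable under linear maps and limits, and determines the law.
  For a symmetric kernel it is equivalent to being a centered Gaussian process
  with covariance \<open>K\<close>.\<close>

definition jointly_gaussian :: "'a measure \<Rightarrow> ('i \<Rightarrow> 'a \<Rightarrow> real) \<Rightarrow> ('i \<Rightarrow> 'i \<Rightarrow> real) \<Rightarrow> bool" where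
  "jointly_gaussian M X K \<longleftrightarrow> prob_space M \<and> (\<forall>i. X i \<in> borel_measurable M) \<and>
     (\<forall>J a. finite J \<longrightarrow> (CLINT \<omega>|M. iexp (\<Sum>i\<in>J. a i * X i \<omega>)) =
        of_real (exp (- (\<Sum>i\<in>J. \<Sum>j\<in>J. a i * a j * K i j) / 2)))"

lemma jointly_gaussianD:
  assumes "jointly_gaussian M X K"
  shows "prob_space M" "X i \<in> borel_measurable M"
    "finite J \<Longrightarrow> (CLINT \<omega>|M. iexp (\<Sum>i\<in>J. a i * X i \<omega>)) =
        of_real (exp (- (\<Sum>i\<in>J. \<Sum>j\<in>J. a i * a j * K i j) / 2))"
  using assms unfolding jointly_gaussian_def by blast+

text \<open>A characteristic function is bounded by \<open>1\<close>, which forces the quadratic form to be nonnegative;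
  replacing the coefficients \<open>a\<close> by \<open>t * a\<close> then gives the whole characteristic function of the linear
  combination.\<close>

lemma jointly_gaussian_linear_combination:
  fixes a :: "'i \<Rightarrow> real"
  assumes G: "jointly_gaussian M X K" and J: "finite J"
  defines "Q \<equiv> \<Sum>i\<in>J. \<Sum>j\<in>J. a i * a j * K i j"
  shows "0 \<le> Q"
    and "distr M borel (\<lambda>\<omega>. \<Sum>i\<in>J. a i * X i \<omega>) = centered_normal (sqrt Q)"
proof -
  interpret prob_space M by (rule jointly_gaussianD(1)[OF G])
  have [measurable]: "X i \<in> borel_measurable M" for i
    by (rule jointly_gaussianD(2)[OF G])
  let ?S = "\<lambda>\<omega>. \<Sum>i\<in>J. a i * X i \<omega>"
  interpret S: real_distribution "distr M borel ?S"
    by (rule real_distribution_distr) simp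
  have char: "char (distr M borel ?S) t = of_real (exp (- (Q * t\<^sup>2) / 2))" for t
  proof -
    have "char (distr M borel ?S) t = (CLINT \<omega>|M. iexp (\<Sum>i\<in>J. (t * a i) * X i \<omega>))"
      unfolding char_def by (subst integral_distr) (auto simp: sum_distrib_left mult_ac)
    also have "\<dots> = of_real (exp (- (\<Sum>i\<in>J. \<Sum>j\<in>J. (t * a i) * (t * a j) * K i j) / 2))"
      by (rule jointly_gaussianD(3)[OF G J])
    also have "(\<Sum>i\<in>J. \<Sum>j\<in>J. (t * a i) * (t * a j) * K i j) = Q * t\<^sup>2"
      unfolding Q_def sum_distrib_right by (intro sum.cong) (auto simp: power2_eq_square)
    finally show ?thesis .
  qed
  show Q: "0 \<le> Q"
    using S.cmod_char_le_1[of 1] by (simp add: char)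
  show "distr M borel ?S = centered_normal (sqrt Q)"
    using Q by (intro Levy_uniqueness S.real_distribution_axioms real_distribution_centered_normal ext)
      (auto simp: char char_centered_normal)
qed

lemma law_centered_normal_moments:
  assumes X: "X \<in> borel_measurable M"
    and D: "distr M borel X = centered_normal \<sigma>" and \<sigma>: "0 \<le> \<sigma>"
  shows "integrable M X" "integrable M (\<lambda>\<omega>. (X \<omega>)\<^sup>2)" "(\<integral>\<omega>. X \<omega> \<partial>M) = 0" "(\<integral>\<omega>. (X \<omega>)\<^sup>2 \<partial>M) = \<sigma>\<^sup>2"
proof -
  have 1: "integrable (distr M borel X) (\<lambda>x. x)"
    using integrable_centered_normal_moment[OF \<sigma>, of 1] unfolding D by simp
  then show "integrable M X" by (rule integrable_distr[OF X])
  have 2: "integrable (distr M borel X) (\<lambda>x. x\<^sup>2)"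
    unfolding D by (rule integrable_centered_normal_moment[OF \<sigma>])
  then show "integrable M (\<lambda>\<omega>. (X \<omega>)\<^sup>2)" by (rule integrable_distr[OF X])
  have "(\<integral>\<omega>. X \<omega> \<partial>M) = (\<integral>x. x \<partial>distr M borel X)"
    by (rule integral_distr[OF X, symmetric]) simp
  then show "(\<integral>\<omega>. X \<omega> \<partial>M) = 0" unfolding D integral_centered_normal[OF \<sigma>] .
  have "(\<integral>\<omega>. (X \<omega>)\<^sup>2 \<partial>M) = (\<integral>x. x\<^sup>2 \<partial>distr M borel X)"
    by (rule integral_distr[OF X, symmetric]) simp
  then show "(\<integral>\<omega>. (X \<omega>)\<^sup>2 \<partial>M) = \<sigma>\<^sup>2" unfolding D integral_centered_normal_square[OF \<sigma>] .
qed

lemma integrable_product_of_square_integrable: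
  fixes X Y :: "'a \<Rightarrow> real"
  assumes [measurable]: "X \<in> borel_measurable M" "Y \<in> borel_measurable M"
    and "integrable M (\<lambda>\<omega>. (X \<omega>)\<^sup>2)" "integrable M (\<lambda>\<omega>. (Y \<omega>)\<^sup>2)"
  shows "integrable M (\<lambda>\<omega>. X \<omega> * Y \<omega>)"
proof (rule Bochner_Integration.integrable_bound)
  show "integrable M (\<lambda>\<omega>. (X \<omega>)\<^sup>2 + (Y \<omega>)\<^sup>2)" using assms by simp
  have "\<bar>x * y\<bar> \<le> x\<^sup>2 + y\<^sup>2" for x y :: real
    using sum_squares_bound[of "\<bar>x\<bar>" "\<bar>y\<bar>"] abs_ge_zero[of "x * y"]
    unfolding abs_mult power2_abs by linarith
  then show "AE \<omega> in M. norm (X \<omega> * Y \<omega>) \<le> norm ((X \<omega>)\<^sup>2 + (Y \<omega>)\<^sup>2)"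
    by simp
qed simp

lemma jointly_gaussian_imp_centered_gaussian_process:
  assumes "jointly_gaussian M X K"
  shows "centered_gaussian_process M X"
  unfolding centered_gaussian_process_def
proof (intro conjI allI impI)
  fix J :: "'b set" and a :: "'b \<Rightarrow> real" assume J: "finite J"
  let ?Q = "\<Sum>i\<in>J. \<Sum>j\<in>J. a i * a j * K i j"
  show "\<exists>\<sigma>\<ge>0. distr M borel (\<lambda>\<omega>. \<Sum>i\<in>J. a i * X i \<omega>) = centered_normal \<sigma>"
    using jointly_gaussian_linear_combination[OF assms J, of a]
    by (intro exI[of _ "sqrt ?Q"]) simp
qed (use jointly_gaussianD(1,2)[OF assms] in auto)

lemma centered_gaussian_processD:
  assumes "centered_gaussian_process M X" "finite J"
  shows "\<exists>\<sigma>\<ge>0. distr M borel (\<lambda>\<omega>. \<Sum>i\<in>J. a i * X i \<omega>) = centered_normal \<sigma>"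
  using assms unfolding centered_gaussian_process_def by simp

lemma centered_gaussian_process_moments:
  assumes G: "centered_gaussian_process M X"
  shows "integrable M (X i)" "(\<integral>\<omega>. X i \<omega> \<partial>M) = 0"
    "integrable M (\<lambda>\<omega>. X i \<omega> * X j \<omega>)"
    "covariance M (X i) (X j) = (\<integral>\<omega>. X i \<omega> * X j \<omega> \<partial>M)"
proof -
  have meas [measurable]: "X i \<in> borel_measurable M" for i
    using G by (simp add: centered_gaussian_process_def)
  have "\<exists>\<sigma>\<ge>0. distr M borel (X i) = centered_normal \<sigma>" for i
    using centered_gaussian_processD[OF G, of "{i}" "\<lambda>_. 1"] by simp
  then obtain \<sigma> where \<sigma>: "\<And>i. 0 \<le> \<sigma> i" "\<And>i. distr M borel (X i) = centered_normal (\<sigma> i)"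
    by metis
  have mom: "integrable M (X i) \<and> (\<integral>\<omega>. X i \<omega> \<partial>M) = 0 \<and> integrable M (\<lambda>\<omega>. (X i \<omega>)\<^sup>2)" for i
    using law_centered_normal_moments(1-3)[OF meas \<sigma>(2,1), of i] by simp
  then show "integrable M (X i)" "(\<integral>\<omega>. X i \<omega> \<partial>M) = 0" by auto
  show "integrable M (\<lambda>\<omega>. X i \<omega> * X j \<omega>)"
    using mom by (intro integrable_product_of_square_integrable) auto
  show "covariance M (X i) (X j) = (\<integral>\<omega>. X i \<omega> * X j \<omega> \<partial>M)"
    using mom by (simp add: covariance_def)
qed

text \<open>Polarization: second moments of sums are variances of normal laws, and they determine the mixed
  moments. This avoids any discussion of convergence in \<open>L\<^sup>2\<close> when the family arises as a limit.\<close>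

lemma jointly_gaussian_covariance:
  assumes G: "jointly_gaussian M X K" and sym: "\<And>i j. K i j = K j i"
  shows "covariance M (X i) (X j) = K i j"
proof -
  have meas [measurable]: "X i \<in> borel_measurable M" for i
    by (rule jointly_gaussianD(2)[OF G])
  note mom = centered_gaussian_process_moments[OF jointly_gaussian_imp_centered_gaussian_process[OF G]]
  have sq: "(\<integral>\<omega>. (\<Sum>i\<in>J. X i \<omega>)\<^sup>2 \<partial>M) = (\<Sum>i\<in>J. \<Sum>j\<in>J. K i j)" if "finite J" for J
  proof -
    have "(\<integral>\<omega>. (\<Sum>i\<in>J. 1 * X i \<omega>)\<^sup>2 \<partial>M) = (sqrt (\<Sum>i\<in>J. \<Sum>j\<in>J. 1 * 1 * K i j))\<^sup>2"
    proof (rule law_centered_normal_moments(4))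
      show "distr M borel (\<lambda>\<omega>. \<Sum>i\<in>J. 1 * X i \<omega>) =
          centered_normal (sqrt (\<Sum>i\<in>J. \<Sum>j\<in>J. 1 * 1 * K i j))"
        by (rule jointly_gaussian_linear_combination(2)[OF G that])
      show "0 \<le> sqrt (\<Sum>i\<in>J. \<Sum>j\<in>J. 1 * 1 * K i j)"
        by (rule real_sqrt_ge_zero[OF jointly_gaussian_linear_combination(1)[OF G that]])
    qed measurable
    then show ?thesis
      using jointly_gaussian_linear_combination(1)[OF G that, of "\<lambda>_. 1"] by simp
  qed
  have diag: "(\<integral>\<omega>. X i \<omega> * X i \<omega> \<partial>M) = K i i" for i
    using sq[of "{i}"] by (simp add: power2_eq_square)
  have "(\<integral>\<omega>. X i \<omega> * X j \<omega> \<partial>M) = K i j"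
  proof (cases "i = j")
    case False
    have "(\<integral>\<omega>. (X i \<omega> + X j \<omega>)\<^sup>2 \<partial>M) = K i i + 2 * K i j + K j j"
      using sq[of "{i, j}"] False sym[of i j] by simp
    moreover have "(\<integral>\<omega>. (X i \<omega> + X j \<omega>)\<^sup>2 \<partial>M) =
        (\<integral>\<omega>. X i \<omega> * X i \<omega> + 2 * (X i \<omega> * X j \<omega>) + X j \<omega> * X j \<omega> \<partial>M)"
      by (intro Bochner_Integration.integral_cong) (auto simp: power2_eq_square algebra_simps)
    moreover have "\<dots> = (\<integral>\<omega>. X i \<omega> * X i \<omega> \<partial>M) + 2 * (\<integral>\<omega>. X i \<omega> * X j \<omega> \<partial>M) + (\<integral>\<omega>. X j \<omega> * X j \<omega> \<partial>M)"
      using mom(3) by simp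
    ultimately show ?thesis using diag by simp
  qed (simp add: diag)
  then show ?thesis using mom(4) by simp
qed

lemma centered_gaussian_process_imp_jointly_gaussian:
  assumes G: "centered_gaussian_process M X" and K: "\<And>i j. covariance M (X i) (X j) = K i j"
  shows "jointly_gaussian M X K"
  unfolding jointly_gaussian_def
proof (intro conjI allI impI)
  show "prob_space M" and meas [measurable]: "X i \<in> borel_measurable M" for i
    using G by (auto simp: centered_gaussian_process_def)
  fix J :: "'b set" and a :: "'b \<Rightarrow> real" assume J: "finite J"
  let ?S = "\<lambda>\<omega>. \<Sum>i\<in>J. a i * X i \<omega>"
  obtain \<sigma> where \<sigma>: "0 \<le> \<sigma>" "distr M borel ?S = centered_normal \<sigma>"
    using centered_gaussian_processD[OF G J, of a] by blast
  note mom = centered_gaussian_process_moments[OF G]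
  have "\<sigma>\<^sup>2 = (\<integral>\<omega>. (?S \<omega>)\<^sup>2 \<partial>M)"
    by (rule law_centered_normal_moments(4)[symmetric, OF _ \<sigma>(2,1)]) simp
  also have "\<dots> = (\<integral>\<omega>. (\<Sum>i\<in>J. \<Sum>j\<in>J. (a i * a j) * (X i \<omega> * X j \<omega>)) \<partial>M)"
    by (simp add: power2_eq_square sum_product mult_ac)
  also have "\<dots> = (\<Sum>i\<in>J. \<Sum>j\<in>J. a i * a j * K i j)"
    using mom(3,4) K by (simp add: Bochner_Integration.integral_sum Bochner_Integration.integrable_sum)
  finally have Q: "\<sigma>\<^sup>2 = (\<Sum>i\<in>J. \<Sum>j\<in>J. a i * a j * K i j)" .
  have "(CLINT \<omega>|M. iexp (?S \<omega>)) = char (distr M borel ?S) 1"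
    unfolding char_def by (subst integral_distr) auto
  also have "\<dots> = of_real (exp (- \<sigma>\<^sup>2 / 2))"
    unfolding \<sigma>(2) by (simp add: char_centered_normal[OF \<sigma>(1)])
  finally show "(CLINT \<omega>|M. iexp (?S \<omega>)) =
      of_real (exp (- (\<Sum>i\<in>J. \<Sum>j\<in>J. a i * a j * K i j) / 2))" by (simp only: Q)
qed

lemma jointly_gaussian_linear_image:
  assumes G: "jointly_gaussian M X K" and S: "\<And>p. finite (S p)"
    and Y: "\<And>p \<omega>. Y p \<omega> = (\<Sum>k\<in>S p. h p k * X k \<omega>)"
    and L: "\<And>p q. L p q = (\<Sum>k\<in>S p. \<Sum>l\<in>S q. h p k * h q l * K k l)"
  shows "jointly_gaussian M Y L"
  unfolding jointly_gaussian_def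
proof (intro conjI allI impI)
  have [measurable]: "X i \<in> borel_measurable M" for i
    by (rule jointly_gaussianD(2)[OF G])
  show "prob_space M" by (rule jointly_gaussianD(1)[OF G])
  show "Y i \<in> borel_measurable M" for i
    unfolding Y[abs_def] by measurable
  fix J :: "'c set" and a :: "'c \<Rightarrow> real" assume J: "finite J"
  define U where "U = (\<Union>p\<in>J. S p)"
  define h' where "h' p k = (if k \<in> S p then h p k else 0)" for p k
  define b where "b k = (\<Sum>p\<in>J. a p * h' p k)" for k
  have U: "finite U" using J S by (auto simp: U_def)
  have Y': "Y p \<omega> = (\<Sum>k\<in>U. h' p k * X k \<omega>)" if "p \<in> J" for p \<omega>
    unfolding Y using that U by (intro sum.mono_neutral_cong_left) (auto simp: U_def h'_def)
  have L': "L p q = (\<Sum>k\<in>U. \<Sum>l\<in>U. h' p k * h' q l * K k l)" if "p \<in> J" "q \<in> J" for p q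
    unfolding L using that U S
    by (intro sum.mono_neutral_cong_left) (auto simp: U_def h'_def sum.If_cases
        intro!: sum.mono_neutral_cong_left)
  have "(\<Sum>p\<in>J. a p * Y p \<omega>) = (\<Sum>k\<in>U. b k * X k \<omega>)" for \<omega>
  proof -
    have "(\<Sum>p\<in>J. a p * Y p \<omega>) = (\<Sum>p\<in>J. \<Sum>k\<in>U. a p * h' p k * X k \<omega>)"
      using Y' by (simp add: sum_distrib_left mult.assoc)
    also have "\<dots> = (\<Sum>k\<in>U. b k * X k \<omega>)"
      unfolding b_def sum_distrib_right by (rule sum.swap)
    finally show ?thesis .
  qed
  moreover have "(\<Sum>p\<in>J. \<Sum>q\<in>J. a p * a q * L p q) = (\<Sum>k\<in>U. \<Sum>l\<in>U. b k * b l * K k l)"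
  proof -
    have "(\<Sum>p\<in>J. \<Sum>q\<in>J. a p * a q * L p q) =
        (\<Sum>p\<in>J. \<Sum>q\<in>J. \<Sum>k\<in>U. \<Sum>l\<in>U. (a p * h' p k) * (a q * h' q l) * K k l)"
      using L' by (simp add: sum_distrib_left mult_ac)
    also have "\<dots> = (\<Sum>p\<in>J. \<Sum>k\<in>U. \<Sum>q\<in>J. \<Sum>l\<in>U. (a p * h' p k) * (a q * h' q l) * K k l)"
      by (intro sum.cong refl sum.swap)
    also have "\<dots> = (\<Sum>k\<in>U. \<Sum>p\<in>J. \<Sum>q\<in>J. \<Sum>l\<in>U. (a p * h' p k) * (a q * h' q l) * K k l)"
      by (rule sum.swap)
    also have "\<dots> = (\<Sum>k\<in>U. \<Sum>p\<in>J. \<Sum>l\<in>U. \<Sum>q\<in>J. (a p * h' p k) * (a q * h' q l) * K k l)"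
      by (intro sum.cong refl sum.swap)
    also have "\<dots> = (\<Sum>k\<in>U. \<Sum>l\<in>U. \<Sum>p\<in>J. \<Sum>q\<in>J. (a p * h' p k) * (a q * h' q l) * K k l)"
      by (intro sum.cong refl sum.swap)
    also have "\<dots> = (\<Sum>k\<in>U. \<Sum>l\<in>U. b k * b l * K k l)"
      unfolding b_def sum_product by (simp only: sum_distrib_right)
    finally show ?thesis .
  qed
  ultimately show "(CLINT \<omega>|M. iexp (\<Sum>p\<in>J. a p * Y p \<omega>)) =
      of_real (exp (- (\<Sum>p\<in>J. \<Sum>q\<in>J. a p * a q * L p q) / 2))"
    using jointly_gaussianD(3)[OF G U, of b] by simp
qed

text \<open>Characteristic functions pass to almost sure limits by dominated convergence.\<close>

lemma jointly_gaussian_limit: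
  assumes G: "\<And>n. jointly_gaussian M (X n) (K n)"
    and meas: "\<And>i. Y i \<in> borel_measurable M"
    and lim: "\<And>i. AE \<omega> in M. (\<lambda>n. X n i \<omega>) \<longlonglongrightarrow> Y i \<omega>"
    and K: "\<And>i j. (\<lambda>n. K n i j) \<longlonglongrightarrow> L i j"
  shows "jointly_gaussian M Y L"
  unfolding jointly_gaussian_def
proof (intro conjI allI impI)
  show "prob_space M" by (rule jointly_gaussianD(1)[OF G])
  then interpret prob_space M .
  note [measurable] = meas
  show "Y i \<in> borel_measurable M" for i by (rule meas)
  have [measurable]: "X n i \<in> borel_measurable M" for n i
    by (rule jointly_gaussianD(2)[OF G])
  fix J :: "'b set" and a :: "'b \<Rightarrow> real" assume J: "finite J"
  have "AE \<omega> in M. \<forall>i\<in>J. (\<lambda>n. X n i \<omega>) \<longlonglongrightarrow> Y i \<omega>"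
    using J lim by (intro AE_finite_allI) auto
  then have "AE \<omega> in M. (\<lambda>n. iexp (\<Sum>i\<in>J. a i * X n i \<omega>)) \<longlonglongrightarrow> iexp (\<Sum>i\<in>J. a i * Y i \<omega>)"
    by eventually_elim (auto intro!: tendsto_intros)
  then have "(\<lambda>n. CLINT \<omega>|M. iexp (\<Sum>i\<in>J. a i * X n i \<omega>)) \<longlonglongrightarrow> (CLINT \<omega>|M. iexp (\<Sum>i\<in>J. a i * Y i \<omega>))"
    by (intro integral_dominated_convergence[where w = "\<lambda>_. 1"])
      (simp_all only: norm_exp_i_times integrable_const order_refl eventually_True, measurable)
  moreover have "(\<lambda>n. CLINT \<omega>|M. iexp (\<Sum>i\<in>J. a i * X n i \<omega>)) \<longlonglongrightarrow>
      of_real (exp (- (\<Sum>i\<in>J. \<Sum>j\<in>J. a i * a j * L i j) / 2))"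
    unfolding jointly_gaussianD(3)[OF G J] by (intro tendsto_intros K) simp
  ultimately show "(CLINT \<omega>|M. iexp (\<Sum>i\<in>J. a i * Y i \<omega>)) =
      of_real (exp (- (\<Sum>i\<in>J. \<Sum>j\<in>J. a i * a j * L i j) / 2))"
    by (rule LIMSEQ_unique)
qed

section \<open>Uniqueness of Gaussian laws\<close>

text \<open>Weighting the law of \<open>X\<close> by a density \<open>W\<close> and normalizing yields a probability measure on the line;
  the one-dimensional theory applies to it. The lower bound \<open>1\<close> keeps the normalization away from \<open>0\<close>.\<close>

lemma tilted_law:
  fixes W X :: "'a \<Rightarrow> real"
  assumes P: "prob_space P" and [measurable]: "W \<in> borel_measurable P" "X \<in> borel_measurable P"
    and W: "\<And>\<omega>. 1 \<le> W \<omega>" "\<And>\<omega>. W \<omega> \<le> C"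
  defines "w \<equiv> \<integral>\<omega>. W \<omega> \<partial>P"
  defines "L \<equiv> distr (density P (\<lambda>\<omega>. ennreal (W \<omega> / w))) borel X"
  shows "1 \<le> w" "real_distribution L"
    and "char L s = of_real (1 / w) * (CLINT \<omega>|P. W \<omega> * iexp (s * X \<omega>))"
    and "B \<in> sets borel \<Longrightarrow> measure L B = (\<integral>\<omega>. W \<omega> * indicator B (X \<omega>) \<partial>P) / w"
proof -
  interpret prob_space P by fact
  have W0: "0 \<le> W \<omega>" for \<omega> using W(1)[of \<omega>] by simp
  have int [simp]: "integrable P W"
    using W W0 by (intro integrable_const_bound[of _ C]) auto
  show w: "1 \<le> w" unfolding w_def using W(1) by (intro integral_ge_const) auto
  let ?D = "density P (\<lambda>\<omega>. ennreal (W \<omega> / w))"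
  have "emeasure ?D (space ?D) = (\<integral>\<^sup>+\<omega>. ennreal (W \<omega> / w) \<partial>P)"
    by (subst emeasure_density) (auto intro!: nn_integral_cong)
  also have "\<dots> = ennreal (\<integral>\<omega>. W \<omega> / w \<partial>P)"
    using w W0 by (intro nn_integral_eq_integral) auto
  also have "\<dots> = 1" using w by (simp add: w_def)
  finally interpret D: prob_space ?D by (rule prob_spaceI)
  show "real_distribution L" unfolding L_def
    by (rule D.real_distribution_distr) simp
  have Wc: "(CLINT \<omega>|P. W \<omega> * f \<omega>) = (CLINT \<omega>|P. W \<omega> *\<^sub>R f \<omega>)" for f :: "'a \<Rightarrow> complex"
    by (simp add: scaleR_conv_of_real)
  have "char L s = (CLINT \<omega>|?D. iexp (s * X \<omega>))"
    unfolding char_def L_def by (subst integral_distr) auto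
  also have "\<dots> = (CLINT \<omega>|P. (W \<omega> / w) *\<^sub>R iexp (s * X \<omega>))"
    using W0 w by (subst integral_density) auto
  also have "\<dots> = (CLINT \<omega>|P. (1 / w) *\<^sub>R (W \<omega> *\<^sub>R iexp (s * X \<omega>)))"
    by (simp add: divide_inverse mult.commute)
  also have "\<dots> = of_real (1 / w) * (CLINT \<omega>|P. W \<omega> * iexp (s * X \<omega>))"
    unfolding Wc integral_scaleR_right by (simp add: scaleR_conv_of_real)
  finally show "char L s = of_real (1 / w) * (CLINT \<omega>|P. W \<omega> * iexp (s * X \<omega>))" .
  show "measure L B = (\<integral>\<omega>. W \<omega> * indicator B (X \<omega>) \<partial>P) / w" if [measurable]: "B \<in> sets borel"
  proof -
    interpret L: real_distribution L by fact
    have "measure L B = (\<integral>x. indicator B x \<partial>L)" by (simp add: L_def)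
    also have "\<dots> = (\<integral>\<omega>. indicator B (X \<omega>) \<partial>?D)"
      unfolding L_def by (subst integral_distr) auto
    also have "\<dots> = (\<integral>\<omega>. (W \<omega> / w) *\<^sub>R indicator B (X \<omega>) \<partial>P)"
      using W0 w by (subst integral_density) auto
    also have "\<dots> = (\<integral>\<omega>. W \<omega> * indicator B (X \<omega>) / w \<partial>P)"
      by (intro Bochner_Integration.integral_cong) auto
    finally show ?thesis by simp
  qed
qed

lemma positively_weighted_law_eqI:
  fixes W X :: "'a \<Rightarrow> real"
  assumes P: "prob_space M" "prob_space N"
    and meas: "W \<in> borel_measurable M" "X \<in> borel_measurable M"
      "W \<in> borel_measurable N" "X \<in> borel_measurable N"
    and W: "\<And>\<omega>. 1 \<le> W \<omega>" "\<And>\<omega>. W \<omega> \<le> C"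
    and eq: "\<And>s. (CLINT \<omega>|M. W \<omega> * iexp (s * X \<omega>)) = (CLINT \<omega>|N. W \<omega> * iexp (s * X \<omega>))"
    and B: "B \<in> sets borel"
  shows "(\<integral>\<omega>. W \<omega> * indicator B (X \<omega>) \<partial>M) = (\<integral>\<omega>. W \<omega> * indicator B (X \<omega>) \<partial>N)"
proof -
  note TM = tilted_law[OF P(1) meas(1,2) W] and TN = tilted_law[OF P(2) meas(3,4) W]
  have w: "(\<integral>\<omega>. W \<omega> \<partial>M) = (\<integral>\<omega>. W \<omega> \<partial>N)"
    using eq[of 0] by (simp add: integral_complex_of_real)
  have "distr (density M (\<lambda>\<omega>. ennreal (W \<omega> / (\<integral>\<omega>. W \<omega> \<partial>M)))) borel X =
      distr (density N (\<lambda>\<omega>. ennreal (W \<omega> / (\<integral>\<omega>. W \<omega> \<partial>N)))) borel X"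
    by (intro Levy_uniqueness TM(2) TN(2) ext) (subst TM(3), subst TN(3), simp only: eq w)
  then have "(\<integral>\<omega>. W \<omega> * indicator B (X \<omega>) \<partial>M) / (\<integral>\<omega>. W \<omega> \<partial>M) =
      (\<integral>\<omega>. W \<omega> * indicator B (X \<omega>) \<partial>N) / (\<integral>\<omega>. W \<omega> \<partial>N)"
    using TM(4)[OF B] TN(4)[OF B] by simp
  then show ?thesis using TM(1) TN(1) w by simp
qed

text \<open>A signed bounded weight \<open>G\<close> is the difference of the positive weights \<open>G + 2\<close> and \<open>2\<close>.\<close>

lemma weighted_law_eqI:
  fixes G X :: "'a \<Rightarrow> real"
  assumes P: "prob_space M" "prob_space N"
    and meas: "G \<in> borel_measurable M" "X \<in> borel_measurable M"
      "G \<in> borel_measurable N" "X \<in> borel_measurable N"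
    and G: "\<And>\<omega>. \<bar>G \<omega>\<bar> \<le> 1"
    and eqG: "\<And>s. (CLINT \<omega>|M. G \<omega> * iexp (s * X \<omega>)) = (CLINT \<omega>|N. G \<omega> * iexp (s * X \<omega>))"
    and eq1: "\<And>s. (CLINT \<omega>|M. iexp (s * X \<omega>)) = (CLINT \<omega>|N. iexp (s * X \<omega>))"
    and B: "B \<in> sets borel"
  shows "(\<integral>\<omega>. G \<omega> * indicator B (X \<omega>) \<partial>M) = (\<integral>\<omega>. G \<omega> * indicator B (X \<omega>) \<partial>N)"
proof -
  have split: "(CLINT \<omega>|Q. (G \<omega> + 2) * iexp (s * X \<omega>)) =
        (CLINT \<omega>|Q. G \<omega> * iexp (s * X \<omega>)) + 2 * (CLINT \<omega>|Q. iexp (s * X \<omega>))"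
      "(\<integral>\<omega>. (G \<omega> + 2) * indicator B (X \<omega>) \<partial>Q) =
        (\<integral>\<omega>. G \<omega> * indicator B (X \<omega>) \<partial>Q) + 2 * (\<integral>\<omega>. 1 * indicator B (X \<omega>) \<partial>Q)"
    if Q: "prob_space Q" "G \<in> borel_measurable Q" "X \<in> borel_measurable Q" for Q s
  proof -
    interpret Q: prob_space Q by fact
    note [measurable] = Q(2,3) B
    have "integrable Q (\<lambda>\<omega>. complex_of_real (G \<omega>) * iexp (s * X \<omega>))"
      "integrable Q (\<lambda>\<omega>. iexp (s * X \<omega>))"
      using G by (auto intro!: Q.integrable_const_bound[of _ 1] simp: norm_mult simp del: of_real_mult)
    then show "(CLINT \<omega>|Q. (G \<omega> + 2) * iexp (s * X \<omega>)) =
        (CLINT \<omega>|Q. G \<omega> * iexp (s * X \<omega>)) + 2 * (CLINT \<omega>|Q. iexp (s * X \<omega>))"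
      by (simp add: distrib_right)
    have "integrable Q (\<lambda>\<omega>. G \<omega> * indicator B (X \<omega>))"
      "integrable Q (\<lambda>\<omega>. indicator B (X \<omega>) :: real)"
      using G by (auto intro!: Q.integrable_const_bound[of _ 1] simp: indicator_def)
    then show "(\<integral>\<omega>. (G \<omega> + 2) * indicator B (X \<omega>) \<partial>Q) =
        (\<integral>\<omega>. G \<omega> * indicator B (X \<omega>) \<partial>Q) + 2 * (\<integral>\<omega>. 1 * indicator B (X \<omega>) \<partial>Q)"
      by (simp add: distrib_right)
  qed
  have "(\<integral>\<omega>. (G \<omega> + 2) * indicator B (X \<omega>) \<partial>M) = (\<integral>\<omega>. (G \<omega> + 2) * indicator B (X \<omega>) \<partial>N)"
  proof (rule positively_weighted_law_eqI[OF P _ meas(2) _ meas(4) _ _ _ B, where C = 3])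
    show "1 \<le> G \<omega> + 2" "G \<omega> + 2 \<le> 3" for \<omega> using G[of \<omega>] by auto
    show "(CLINT \<omega>|M. of_real (G \<omega> + 2) * iexp (s * X \<omega>)) =
        (CLINT \<omega>|N. of_real (G \<omega> + 2) * iexp (s * X \<omega>))" for s
      using split(1)[OF P(1) meas(1,2), of s] split(1)[OF P(2) meas(3,4), of s] eqG[of s] eq1[of s]
      by simp
  qed (use meas in measurable)
  moreover have "(\<integral>\<omega>. 1 * indicator B (X \<omega>) \<partial>M) = (\<integral>\<omega>. (1 :: real) * indicator B (X \<omega>) \<partial>N)"
  proof (rule positively_weighted_law_eqI[OF P _ meas(2) _ meas(4) _ _ _ B, where C = 1])
    show "(CLINT \<omega>|M. of_real 1 * iexp (s * X \<omega>)) = (CLINT \<omega>|N. of_real 1 * iexp (s * X \<omega>))" for s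
      by (simp only: of_real_1 mult_1_left eq1)
  qed simp_all
  ultimately show ?thesis
    using split(2)[OF P(1) meas(1,2)] split(2)[OF P(2) meas(3,4)] by simp
qed

text \<open>The transforms of the two measures agree for exponentials of linear forms. One after the other,
  coordinates are upgraded from an exponential to the indicator of an arbitrary Borel set: the product of
  the indicators already obtained and of the cosine or sine of a linear form is a bounded real weight, and
  \<open>weighted_law_eqI\<close> is applied to the next coordinate under this weight.\<close>

lemma measure_eqI_linear_combination_char:
  fixes M N :: "('i \<Rightarrow> real) measure"
  assumes P: "prob_space M" "prob_space N"
    and sets: "sets M = sets (PiM UNIV (\<lambda>_. borel))" "sets N = sets (PiM UNIV (\<lambda>_. borel))"
    and eq: "\<And>J a. finite J \<Longrightarrow>
      (CLINT \<omega>|M. iexp (\<Sum>i\<in>J. a i * \<omega> i)) = (CLINT \<omega>|N. iexp (\<Sum>i\<in>J. a i * \<omega> i))"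
  shows "M = N"
proof (rule measure_eqI_PiM_infinite[OF sets])
  interpret M: prob_space M by fact
  interpret N: prob_space N by fact
  show "finite_measure M" by (rule M.finite_measure_axioms)
  fix A :: "'i \<Rightarrow> real set" and J assume J: "finite J" and A: "\<And>i. i \<in> J \<Longrightarrow> A i \<in> sets borel"
  have coord: "(\<lambda>\<omega>. \<omega> k) \<in> borel_measurable M" "(\<lambda>\<omega>. \<omega> k) \<in> borel_measurable N" for k
    by (simp_all add: measurable_cong_sets[OF sets(1) refl] measurable_cong_sets[OF sets(2) refl])
  define I where "I K \<omega> = (\<Prod>k\<in>K. indicator (A k) (\<omega> k) :: real)" for K and \<omega> :: "'i \<Rightarrow> real"
  define S where "S a \<omega> = (\<Sum>j\<in>J. a j * \<omega> j)" for a and \<omega> :: "'i \<Rightarrow> real"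
  have I_bound: "0 \<le> I K \<omega>" "I K \<omega> \<le> 1" for K \<omega>
    by (auto simp: I_def intro!: prod_nonneg prod_le_1)
  have S_meas: "S a \<in> borel_measurable M" "S a \<in> borel_measurable N" for a
    unfolding S_def using coord by (auto intro!: borel_measurable_sum borel_measurable_times)
  have I_meas: "I K \<in> borel_measurable M" "I K \<in> borel_measurable N" if "K \<subseteq> J" for K
    unfolding I_def using coord A that
    by (auto intro!: borel_measurable_prod borel_measurable_indicator' measurable_compose)
  have key: "(CLINT \<omega>|M. I K \<omega> * iexp (S a \<omega>)) = (CLINT \<omega>|N. I K \<omega> * iexp (S a \<omega>))"
    if "K \<subseteq> J" for K a
    using finite_subset[OF that J] that
  proof (induction K arbitrary: a rule: finite_induct)
    case empty
    then show ?case using eq[OF J] by (simp add: I_def S_def)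
  next
    case (insert k K)
    then have kJ: "k \<in> J" and KJ: "K \<subseteq> J" by auto
    note IH = insert.IH[OF KJ]
    \<comment> \<open>All the transforms that \<open>weighted_law_eqI\<close> requires are instances of the induction hypothesis:
      adding \<open>s * \<omega> k\<close> only changes the coefficient of \<open>\<omega> k\<close>, and cosine and sine are
      combinations of the exponentials of the linear form and of its negative.\<close>
    have shift: "S a \<omega> + s * \<omega> k = S (\<lambda>j. a j + (if j = k then s else 0)) \<omega>" for a s \<omega>
      using J kJ by (simp add: S_def distrib_right sum.distrib if_distrib[of "\<lambda>c. c * _"] sum.delta cong: if_cong)
    have minus: "- S a \<omega> = S (\<lambda>j. - a j) \<omega>" for a \<omega>
      by (simp add: S_def sum_negf)
    have int: "integrable M (\<lambda>\<omega>. I K \<omega> * iexp (S b \<omega>))"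
        "integrable N (\<lambda>\<omega>. I K \<omega> * iexp (S b \<omega>))" for b
      using I_bound[of K] I_meas[OF KJ] S_meas
      by (auto intro!: M.integrable_const_bound[of _ 1] N.integrable_const_bound[of _ 1] simp: norm_mult)
    have one: "(CLINT \<omega>|M. iexp (s * \<omega> k)) = (CLINT \<omega>|N. iexp (s * \<omega> k))" for s
      using eq[of "{k}" "\<lambda>_. s"] by simp
    let ?P = "\<lambda>s \<omega>. I K \<omega> * iexp (S (\<lambda>j. a j + (if j = k then s else 0)) \<omega>)"
    let ?Q = "\<lambda>s \<omega>. I K \<omega> * iexp (S (\<lambda>j. - a j + (if j = k then s else 0)) \<omega>)"
    have PQ: "?P s \<omega> = I K \<omega> * (iexp (S a \<omega>) * iexp (s * \<omega> k))"
        "?Q s \<omega> = I K \<omega> * (iexp (- S a \<omega>) * iexp (s * \<omega> k))" for s \<omega>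
      unfolding shift[symmetric] minus[symmetric] of_real_add distrib_left exp_add by (rule refl)+
    have cosG: "of_real (I K \<omega> * cos (S a \<omega>)) * iexp (s * \<omega> k) = 1/2 * (?P s \<omega> + ?Q s \<omega>)" for s \<omega>
      unfolding PQ cos_of_real[symmetric] of_real_mult cos_exp_eq by (simp add: algebra_simps)
    have sinG: "of_real (I K \<omega> * sin (S a \<omega>)) * iexp (s * \<omega> k) = 1/(2*\<i>) * (?P s \<omega> - ?Q s \<omega>)" for s \<omega>
      unfolding PQ sin_of_real[symmetric] of_real_mult sin_exp_eq by (simp add: algebra_simps diff_divide_distrib)
    have "(\<integral>\<omega>. I K \<omega> * cos (S a \<omega>) * indicator (A k) (\<omega> k) \<partial>M) =
        (\<integral>\<omega>. I K \<omega> * cos (S a \<omega>) * indicator (A k) (\<omega> k) \<partial>N)"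
    proof (rule weighted_law_eqI[OF P _ coord(1) _ coord(2) _ _ one A[OF kJ]])
      show "\<bar>I K \<omega> * cos (S a \<omega>)\<bar> \<le> 1" for \<omega>
        using I_bound[of K \<omega>] by (auto simp: abs_mult intro!: mult_le_one)
      show "(CLINT \<omega>|M. of_real (I K \<omega> * cos (S a \<omega>)) * iexp (s * \<omega> k)) =
          (CLINT \<omega>|N. of_real (I K \<omega> * cos (S a \<omega>)) * iexp (s * \<omega> k))" for s
        unfolding cosG integral_mult_right_zero by (simp only: Bochner_Integration.integral_add[OF int(1) int(1)]
          Bochner_Integration.integral_add[OF int(2) int(2)] IH)
    qed (use I_meas[OF KJ] S_meas[of a] in measurable)
    moreover have "(\<integral>\<omega>. I K \<omega> * sin (S a \<omega>) * indicator (A k) (\<omega> k) \<partial>M) =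
        (\<integral>\<omega>. I K \<omega> * sin (S a \<omega>) * indicator (A k) (\<omega> k) \<partial>N)"
    proof (rule weighted_law_eqI[OF P _ coord(1) _ coord(2) _ _ one A[OF kJ]])
      show "\<bar>I K \<omega> * sin (S a \<omega>)\<bar> \<le> 1" for \<omega>
        using I_bound[of K \<omega>] by (auto simp: abs_mult intro!: mult_le_one)
      show "(CLINT \<omega>|M. of_real (I K \<omega> * sin (S a \<omega>)) * iexp (s * \<omega> k)) =
          (CLINT \<omega>|N. of_real (I K \<omega> * sin (S a \<omega>)) * iexp (s * \<omega> k))" for s
        unfolding sinG integral_mult_right_zero by (simp only: Bochner_Integration.integral_diff[OF int(1) int(1)]
          Bochner_Integration.integral_diff[OF int(2) int(2)] IH)
    qed (use I_meas[OF KJ] S_meas[of a] in measurable)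
    moreover have "(CLINT \<omega>|Q. I (insert k K) \<omega> * iexp (S a \<omega>)) =
        of_real (\<integral>\<omega>. I K \<omega> * cos (S a \<omega>) * indicator (A k) (\<omega> k) \<partial>Q) +
        \<i> * of_real (\<integral>\<omega>. I K \<omega> * sin (S a \<omega>) * indicator (A k) (\<omega> k) \<partial>Q)"
      if Q: "prob_space Q" "I K \<in> borel_measurable Q" "S a \<in> borel_measurable Q"
        "(\<lambda>\<omega>. \<omega> k) \<in> borel_measurable Q" for Q
    proof -
      interpret Q: prob_space Q by fact
      note [measurable] = Q(2-4) A[OF kJ]
      have b: "\<bar>I K \<omega> * c * indicator (A k) (\<omega> k)\<bar> \<le> 1" if "\<bar>c\<bar> \<le> 1" for c \<omega>
        using I_bound[of K \<omega>] that by (auto simp: abs_mult indicator_def intro!: mult_le_one)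
      have i: "integrable Q (\<lambda>\<omega>. I K \<omega> * cos (S a \<omega>) * indicator (A k) (\<omega> k))"
          "integrable Q (\<lambda>\<omega>. I K \<omega> * sin (S a \<omega>) * indicator (A k) (\<omega> k))"
        using b by (auto intro!: Q.integrable_const_bound[of _ 1])
      have "of_real (I (insert k K) \<omega>) * iexp (S a \<omega>) =
          of_real (I K \<omega> * cos (S a \<omega>) * indicator (A k) (\<omega> k)) +
          \<i> * of_real (I K \<omega> * sin (S a \<omega>) * indicator (A k) (\<omega> k))" for \<omega>
      proof -
        have "I (insert k K) \<omega> = indicator (A k) (\<omega> k) * I K \<omega>"
          using insert.hyps by (simp add: I_def)
        moreover have "iexp (S a \<omega>) = of_real (cos (S a \<omega>)) + \<i> * of_real (sin (S a \<omega>))"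
          by (simp add: exp_Euler cos_of_real sin_of_real)
        ultimately show ?thesis by (simp add: algebra_simps)
      qed
      then show ?thesis
        using i by (simp only: Bochner_Integration.integral_add integrable_of_real integrable_mult_right
            integral_mult_right_zero integral_complex_of_real)
    qed
    note this[OF P(1) I_meas(1)[OF KJ] S_meas(1) coord(1)] this[OF P(2) I_meas(2)[OF KJ] S_meas(2) coord(2)]
    ultimately show ?case by simp
  qed
  let ?E = "prod_emb UNIV (\<lambda>_. borel) J (Pi\<^sub>E J A)"
  have E: "?E = {\<omega>. \<forall>k\<in>J. \<omega> k \<in> A k}"
    by (auto simp: prod_emb_def PiE_iff)
  have "?E \<in> sets (PiM UNIV (\<lambda>_. borel))"
    using J A by (intro sets_PiM_I) auto
  then have E_sets: "?E \<in> sets M" "?E \<in> sets N" using sets by auto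
  have ind: "I J = indicator ?E"
  proof
    fix \<omega>
    show "I J \<omega> = indicator ?E \<omega>"
      using J unfolding E by (auto simp: I_def indicator_def prod_zero_iff)
  qed
  have "(\<integral>\<omega>. I J \<omega> \<partial>M) = (\<integral>\<omega>. I J \<omega> \<partial>N)"
    using key[of J "\<lambda>_. 0"] by (simp add: S_def integral_complex_of_real)
  then have "measure M ?E = measure N ?E"
    using E_sets unfolding ind by simp
  then show "emeasure M ?E = emeasure N ?E"
    by (simp add: M.emeasure_eq_measure N.emeasure_eq_measure)
qed

lemma jointly_gaussian_coordinates_unique:
  assumes "jointly_gaussian M (\<lambda>i \<omega>. \<omega> i) K" "jointly_gaussian N (\<lambda>i \<omega>. \<omega> i) K"
    and "sets M = sets (PiM UNIV (\<lambda>_. borel))" "sets N = sets (PiM UNIV (\<lambda>_. borel))"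
  shows "M = N"
  by (rule measure_eqI_linear_combination_char)
    (use assms in \<open>simp_all only: jointly_gaussianD\<close>)

lemma jointly_gaussian_iid_coordinates:
  "jointly_gaussian (PiM UNIV (\<lambda>_ :: 'i. std_normal_distribution)) (\<lambda>i \<omega>. \<omega> i)
     (\<lambda>i j. if i = j then 1 else 0)"
proof -
  let ?N = "std_normal_distribution" and ?M = "PiM UNIV (\<lambda>_ :: 'i. std_normal_distribution)"
  note N = prob_space_std_normal
  interpret P: product_prob_space "\<lambda>_ :: 'i. ?N" UNIV using N by (intro product_prob_spaceI)
  have meas: "(\<lambda>\<omega>. \<omega> i) \<in> borel_measurable ?M" for i
    using measurable_component_singleton[of i UNIV "\<lambda>_. ?N"] by (simp cong: measurable_cong_sets)
  have law: "distr ?M borel (\<lambda>\<omega>. \<omega> i) = ?N" for i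
    using P.PiM_component[of i] by (simp cong: distr_cong)
  have ind: "P.indep_vars (\<lambda>_. borel) (\<lambda>i \<omega>. a i * \<omega> i) J" if "finite J" for J and a :: "'i \<Rightarrow> real"
  proof -
    have "P.indep_vars (\<lambda>_. ?N) (\<lambda>i \<omega>. \<omega> i) UNIV"
      using P.PiM_component by (subst P.indep_vars_iff_distr_eq_PiM') (auto simp: restrict_UNIV)
    then have "P.indep_vars (\<lambda>_. borel) (\<lambda>i \<omega>. (\<lambda>x. a i * x) (\<omega> i)) UNIV"
      by (rule P.indep_vars_compose2) simp
    then show ?thesis by (rule P.indep_vars_subset) simp
  qed
  have char1: "char (distr ?M borel (\<lambda>\<omega>. a * \<omega> i)) 1 = of_real (exp (- a\<^sup>2 / 2))" for a i
  proof -
    have "char (distr ?M borel (\<lambda>\<omega>. a * \<omega> i)) 1 = char (distr ?M borel (\<lambda>\<omega>. \<omega> i)) a"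
      unfolding char_def using meas[of i] by (subst (1 2) integral_distr) auto
    then show ?thesis by (simp add: law char_std_normal_distribution)
  qed
  show ?thesis
    unfolding jointly_gaussian_def
  proof (intro conjI allI impI)
    show "prob_space ?M" by (rule P.prob_space_axioms)
    show "(\<lambda>\<omega>. \<omega> i) \<in> borel_measurable ?M" for i by (rule meas)
    fix J :: "'i set" and a :: "'i \<Rightarrow> real" assume J: "finite J"
    have "(CLINT \<omega>|?M. iexp (\<Sum>i\<in>J. a i * \<omega> i)) = char (distr ?M borel (\<lambda>\<omega>. \<Sum>i\<in>J. a i * \<omega> i)) 1"
      unfolding char_def using meas by (subst integral_distr) auto
    also have "\<dots> = (\<Prod>i\<in>J. of_real (exp (- (a i)\<^sup>2 / 2)))"
      by (simp only: P.char_distr_sum[OF ind[OF J]] char1)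
    also have "\<dots> = of_real (exp (\<Sum>i\<in>J. - (a i)\<^sup>2 / 2))"
      by (simp only: exp_sum[OF J] of_real_prod)
    also have "(\<Sum>i\<in>J. - (a i)\<^sup>2 / 2) = - (\<Sum>i\<in>J. \<Sum>j\<in>J. a i * a j * (if i = j then 1 else 0)) / 2"
      using J by (simp add: if_distrib[of "\<lambda>c. _ * c"] sum.delta' sum_negf sum_divide_distrib power2_eq_square
          cong: if_cong)
    finally show "(CLINT \<omega>|?M. iexp (\<Sum>i\<in>J. a i * \<omega> i)) =
      of_real (exp (- (\<Sum>i\<in>J. \<Sum>j\<in>J. a i * a j * (if i = j then 1 else 0)) / 2))" .
  qed
qed

section \<open>Lattice paths and the square-root kernel of the covariance\<close>

lemma l1_dist_nonneg: "0 \<le> l1_dist i j"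
  by (simp add: l1_dist_def sum_nonneg)

lemma l1_dist_commute: "l1_dist i j = l1_dist j i"
  by (simp add: l1_dist_def abs_minus_commute)

lemma l1_dist_self [simp]: "l1_dist i i = 0"
  by (simp add: l1_dist_def)

lemma l1_dist_triangle: "l1_dist i k \<le> l1_dist i j + l1_dist j k"
  unfolding l1_dist_def sum.distrib[symmetric] by (intro sum_mono) auto

lemma l1_dist_translate [simp]: "l1_dist (i + a) (j + a) = l1_dist i j"
  by (simp add: l1_dist_def)

lemma l1_dist_le_0:
  assumes "l1_dist i j \<le> 0" shows "i = j"
proof -
  have "(\<Sum>k\<in>UNIV. \<bar>i $ k - j $ k\<bar>) = 0"
    using assms l1_dist_nonneg[of i j] unfolding l1_dist_def by linarith
  then show ?thesis by (simp add: sum_nonneg_eq_0_iff vec_eq_iff)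
qed

definition l1_ball :: "nat \<Rightarrow> int ^ 'd \<Rightarrow> (int ^ 'd) set" where
  "l1_ball n i = {j. l1_dist i j \<le> int n}"

definition neighbours :: "int ^ 'd \<Rightarrow> (int ^ 'd) set" where
  "neighbours i = {j. l1_dist i j = 1}"

text \<open>This is \<open>2 * d\<close>; it enters the argument as the exponential growth rate of the number of paths.\<close>

definition lattice_degree :: "'d::finite itself \<Rightarrow> real" where
  "lattice_degree _ = real (card (neighbours (0 :: int ^ 'd)))"

lemma finite_l1_ball [simp]: "finite (l1_ball n i)"
proof (rule finite_subset)
  show "l1_ball n i \<subseteq> (\<lambda>f. \<chi> k. f k) ` (\<Pi>\<^sub>E k\<in>UNIV. {i $ k - int n .. i $ k + int n})"
  proof
    fix j assume "j \<in> l1_ball n i"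
    then have *: "(\<Sum>k\<in>UNIV. \<bar>i $ k - j $ k\<bar>) \<le> int n"
      by (simp add: l1_ball_def l1_dist_def)
    have "\<bar>i $ k - j $ k\<bar> \<le> int n" for k
      using member_le_sum[of k UNIV "\<lambda>k. \<bar>i $ k - j $ k\<bar>"] * by simp
    then have "j $ k \<in> {i $ k - int n .. i $ k + int n}" for k
      by (simp add: abs_le_iff) (smt (verit))
    then show "j \<in> (\<lambda>f. \<chi> k. f k) ` (\<Pi>\<^sub>E k\<in>UNIV. {i $ k - int n .. i $ k + int n})"
      by (intro image_eqI[of _ _ "\<lambda>k. j $ k"]) auto
  qed
qed (auto intro!: finite_imageI finite_PiE)

lemma finite_neighbours [simp]: "finite (neighbours i)"
  by (rule finite_subset[OF _ finite_l1_ball[of 1 i]]) (auto simp: neighbours_def l1_ball_def)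

lemma l1_ball_0 [simp]: "l1_ball 0 i = {i}"
proof -
  have "j = i" if "j \<in> l1_ball 0 i" for j
    using that l1_dist_le_0[of i j] by (simp add: l1_ball_def)
  then show ?thesis by (auto simp: l1_ball_def)
qed

lemma l1_ball_translate: "l1_ball n (i + a) = (\<lambda>j. j + a) ` l1_ball n i"
proof -
  have "j \<in> (\<lambda>j. j + a) ` l1_ball n i" if "j \<in> l1_ball n (i + a)" for j
    using that l1_dist_translate[of i a "j - a"]
    by (intro image_eqI[of _ _ "j - a"]) (auto simp: l1_ball_def)
  then show ?thesis by (auto simp: l1_ball_def)
qed

lemma neighbours_translate: "neighbours (i + a) = (\<lambda>j. j + a) ` neighbours i"
proof -
  have "j \<in> (\<lambda>j. j + a) ` neighbours i" if "j \<in> neighbours (i + a)" for j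
    using that l1_dist_translate[of i a "j - a"]
    by (intro image_eqI[of _ _ "j - a"]) (auto simp: neighbours_def)
  then show ?thesis by (auto simp: neighbours_def)
qed

lemma card_neighbours: "real (card (neighbours (i :: int ^ 'd))) = lattice_degree TYPE('d)"
  using neighbours_translate[of 0 i] by (simp add: lattice_degree_def card_image)

abbreviation path_count :: "nat \<Rightarrow> int ^ 'd \<Rightarrow> int ^ 'd \<Rightarrow> real" where
  "path_count n i j \<equiv> real (card (nn_paths n i j))"

lemma nn_paths_0: "nn_paths 0 i j = (if i = j then {[i]} else {})"
  by (auto simp: nn_paths_def length_Suc_conv)

lemma nn_paths_Suc: "nn_paths (Suc n) i j = (\<Union>k\<in>neighbours i. (#) i ` nn_paths n k j)"
proof (intro equalityI subsetI)
  fix p assume p: "p \<in> nn_paths (Suc n) i j"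
  then obtain q where q: "p = i # q" "length q = Suc n"
    by (cases p) (auto simp: nn_paths_def)
  have steps: "\<forall>k<Suc n. l1_dist (p ! k) (p ! Suc k) = 1" and "last p = j"
    using p by (auto simp: nn_paths_def)
  have ne: "q \<noteq> []" using q by auto
  have "hd q \<in> neighbours i"
    using steps[rule_format, of 0] q ne by (simp add: neighbours_def hd_conv_nth)
  moreover have "q \<in> nn_paths n (hd q) j"
    unfolding nn_paths_def
  proof (intro CollectI conjI allI impI)
    show "l1_dist (q ! k) (q ! Suc k) = 1" if "k < n" for k
      using steps[rule_format, of "Suc k"] that q by simp
  qed (use q ne \<open>last p = j\<close> in auto)
  ultimately show "p \<in> (\<Union>k\<in>neighbours i. (#) i ` nn_paths n k j)"
    using q by auto
next
  fix p assume "p \<in> (\<Union>k\<in>neighbours i. (#) i ` nn_paths n k j)"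
  then obtain k q where q: "k \<in> neighbours i" "q \<in> nn_paths n k j" "p = i # q" by auto
  then have ne: "q \<noteq> []" by (auto simp: nn_paths_def)
  have "l1_dist (p ! m) (p ! Suc m) = 1" if "m < Suc n" for m
    using that q ne by (cases m) (auto simp: nn_paths_def neighbours_def hd_conv_nth)
  then show "p \<in> nn_paths (Suc n) i j"
    using q ne by (auto simp: nn_paths_def)
qed

lemma finite_nn_paths [simp]: "finite (nn_paths n i j)"
proof (induction n arbitrary: i)
  case (Suc n)
  show ?case
    unfolding nn_paths_Suc by (intro finite_UN_I finite_imageI finite_neighbours Suc.IH)
qed (simp add: nn_paths_0)

lemma path_count_0: "path_count 0 i j = (if i = j then 1 else 0)"
  by (simp add: nn_paths_0)

lemma path_count_Suc: "path_count (Suc n) i j = (\<Sum>k\<in>neighbours i. path_count n k j)"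
proof -
  have "card (nn_paths (Suc n) i j) = (\<Sum>k\<in>neighbours i. card ((#) i ` nn_paths n k j))"
    unfolding nn_paths_Suc
  proof (rule card_UN_disjoint)
    show "\<forall>k\<in>neighbours i. \<forall>l\<in>neighbours i. k \<noteq> l \<longrightarrow>
        (#) i ` nn_paths n k j \<inter> (#) i ` nn_paths n l j = {}"
      by (auto simp: nn_paths_def)
  qed (simp_all add: finite_imageI)
  then show ?thesis by (simp add: card_image)
qed

lemma path_count_commute: "path_count n i j = path_count n j i"
proof -
  have "rev p \<in> nn_paths n j i" if p: "p \<in> nn_paths n i j" for p and i j :: "int ^ 'a"
    unfolding nn_paths_def
  proof (intro CollectI conjI allI impI)
    have len: "length p = Suc n" using p by (simp add: nn_paths_def)
    then show "length (rev p) = Suc n" "hd (rev p) = j" "last (rev p) = i"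
      using p by (auto simp: nn_paths_def hd_rev last_rev)
    fix k assume k: "k < n"
    have "l1_dist (p ! (n - Suc k)) (p ! Suc (n - Suc k)) = 1"
      using p k by (simp add: nn_paths_def)
    then show "l1_dist (rev p ! k) (rev p ! Suc k) = 1"
      using k len by (simp add: rev_nth l1_dist_commute Suc_diff_Suc)
  qed
  then have "bij_betw rev (nn_paths n i j) (nn_paths n j i)"
    by (intro bij_betwI[where g = rev]) auto
  then show ?thesis by (simp add: bij_betw_same_card)
qed

lemma path_count_eq_0: "j \<notin> l1_ball n i \<Longrightarrow> path_count n i j = 0"
proof (induction n arbitrary: i)
  case 0
  then show ?case by (auto simp: path_count_0 l1_ball_def)
next
  case (Suc n)
  have "path_count n k j = 0" if k: "k \<in> neighbours i" for k
  proof (rule Suc.IH)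
    show "j \<notin> l1_ball n k"
      using Suc.prems k l1_dist_triangle[of i j k] by (auto simp: l1_ball_def neighbours_def)
  qed
  then show ?case unfolding path_count_Suc by (rule sum.neutral[OF ballI])
qed

text \<open>Cutting a path after \<open>m\<close> steps; the set \<open>B\<close> is any finite set that contains all possible cut points.\<close>

lemma path_count_concat:
  assumes "finite B" and "l1_ball m i \<subseteq> B"
  shows "(\<Sum>k\<in>B. path_count m i k * path_count n k j) = path_count (m + n) i j"
  using assms
proof (induction m arbitrary: i)
  case 0
  then have "i \<in> B" by (auto simp: l1_ball_def)
  then show ?case
    using 0 unfolding path_count_0 by (simp add: if_distrib[of "\<lambda>c. c * _"] sum.delta' cong: if_cong)
next
  case (Suc m)
  have sub: "l1_ball m e \<subseteq> B" if "e \<in> neighbours i" for e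
  proof
    fix k assume "k \<in> l1_ball m e"
    then show "k \<in> B"
      using Suc.prems(2) that l1_dist_triangle[of i k e] by (auto simp: l1_ball_def neighbours_def)
  qed
  have "(\<Sum>k\<in>B. path_count (Suc m) i k * path_count n k j) =
      (\<Sum>e\<in>neighbours i. \<Sum>k\<in>B. path_count m e k * path_count n k j)"
    unfolding path_count_Suc sum_distrib_right by (rule sum.swap)
  also have "\<dots> = (\<Sum>e\<in>neighbours i. path_count (m + n) e j)"
    using Suc.IH[OF Suc.prems(1) sub] by (intro sum.cong) auto
  also have "\<dots> = path_count (Suc m + n) i j"
    by (simp only: path_count_Suc add_Suc)
  finally show ?case .
qed

lemma lattice_degree_nonneg [simp]: "0 \<le> lattice_degree TYPE('d::finite)"
  by (simp add: lattice_degree_def)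

text \<open>A path that starts at \<open>i\<close> has \<open>lattice_degree\<close> choices for each of its \<open>n\<close> steps; only the end point
  is restricted to \<open>B\<close>.\<close>

lemma sum_path_count_le:
  fixes i :: "int ^ 'd"
  assumes "finite B"
  shows "(\<Sum>j\<in>B. path_count n i j) \<le> lattice_degree TYPE('d) ^ n"
proof (induction n arbitrary: i)
  case 0
  then show ?case using assms by (auto simp: path_count_0)
next
  case (Suc n)
  have "(\<Sum>j\<in>B. path_count (Suc n) i j) = (\<Sum>k\<in>neighbours i. \<Sum>j\<in>B. path_count n k j)"
    unfolding path_count_Suc by (rule sum.swap)
  also have "\<dots> \<le> (\<Sum>k\<in>neighbours i. lattice_degree TYPE('d) ^ n)"
    by (intro sum_mono Suc.IH)
  also have "\<dots> = lattice_degree TYPE('d) ^ Suc n"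
    by (simp add: card_neighbours)
  finally show ?case .
qed

lemma path_count_le: "path_count n i (j :: int ^ 'd) \<le> lattice_degree TYPE('d) ^ n"
  using sum_path_count_le[of "{j}" n i] by simp

lemma path_count_translate: "path_count n (i + a) (j + a) = path_count n i j"
proof (induction n arbitrary: i)
  case (Suc n)
  have "path_count (Suc n) (i + a) (j + a) = (\<Sum>k\<in>neighbours i. path_count n (k + a) (j + a))"
    unfolding path_count_Suc neighbours_translate by (subst sum.reindex) auto
  then show ?case by (simp only: Suc.IH path_count_Suc)
qed (simp add: path_count_0)

text \<open>Kernels of the operators whose squares add up to the covariance: layer \<open>0\<close> is the identity divided by
  \<open>sqrt 2\<close>, and layer \<open>Suc m\<close> is \<open>(\<theta> * T) ^ m * (1 + \<theta> * T) / sqrt 2\<close>, where \<open>T\<close> sums over neighbours.\<close>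

definition noise_coeff :: "real \<Rightarrow> nat \<Rightarrow> int ^ 'd \<Rightarrow> int ^ 'd \<Rightarrow> real" where
  "noise_coeff \<theta> n i j =
     (case n of 0 \<Rightarrow> if i = j then 1 else 0
      | Suc m \<Rightarrow> \<theta> ^ m * path_count m i j + \<theta> ^ Suc m * path_count (Suc m) i j) / sqrt 2"

lemma noise_coeff_eq_0:
  assumes "j \<notin> l1_ball n i" shows "noise_coeff \<theta> n i j = 0"
proof (cases n)
  case 0
  then show ?thesis using assms by (auto simp: noise_coeff_def l1_ball_def)
next
  case (Suc m)
  then have "j \<notin> l1_ball m i" using assms by (auto simp: l1_ball_def)
  then show ?thesis using assms Suc by (simp add: noise_coeff_def path_count_eq_0)
qed

lemma noise_coeff_translate: "noise_coeff \<theta> n (i + a) (j + a) = noise_coeff \<theta> n i j"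
  by (simp add: noise_coeff_def path_count_translate split: nat.split)

definition truncated_cov :: "real \<Rightarrow> nat \<Rightarrow> int ^ 'd \<Rightarrow> int ^ 'd \<Rightarrow> real" where
  "truncated_cov \<theta> n i j =
     (\<Sum>m<n. \<Sum>k\<in>l1_ball m i. noise_coeff \<theta> m i k * noise_coeff \<theta> m j k)"

text \<open>The expansion \<open>(x ^ m * (1 + x)) ^ 2 = x ^ (2 * m) + 2 * x ^ (2 * m + 1) + x ^ (2 * m + 2)\<close>, with path counts in
  place of powers: composing kernels is concatenating paths.\<close>

lemma noise_layer_cov_Suc:
  "(\<Sum>k\<in>l1_ball (Suc m) i. noise_coeff \<theta> (Suc m) i k * noise_coeff \<theta> (Suc m) j k) =
     (\<theta> ^ (2 * m) * path_count (2 * m) i j + 2 * (\<theta> ^ (2 * m + 1) * path_count (2 * m + 1) i j)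
       + \<theta> ^ (2 * m + 2) * path_count (2 * m + 2) i j) / 2"
proof -
  let ?B = "l1_ball (Suc m) i"
  have len: "m + m = 2 * m" "m + Suc m = 2 * m + 1" "Suc m + m = 2 * m + 1" "Suc m + Suc m = 2 * m + 2"
    by simp_all
  have sub: "l1_ball m i \<subseteq> ?B" by (auto simp: l1_ball_def)
  have conc: "(\<Sum>k\<in>?B. path_count p i k * path_count q j k) = path_count (p + q) i j"
    if "p = m \<or> p = Suc m" for p q
    unfolding path_count_commute[of q j] using that sub by (intro path_count_concat) auto
  have prod: "noise_coeff \<theta> (Suc m) i k * noise_coeff \<theta> (Suc m) j k =
      (\<theta> ^ (2 * m) * (path_count m i k * path_count m j k)
       + \<theta> ^ (2 * m + 1) * (path_count m i k * path_count (Suc m) j k)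
       + \<theta> ^ (2 * m + 1) * (path_count (Suc m) i k * path_count m j k)
       + \<theta> ^ (2 * m + 2) * (path_count (Suc m) i k * path_count (Suc m) j k)) / 2" for k
  proof -
    have expand: "(x * a + (\<theta> * x) * b) / sqrt 2 * ((x * c + (\<theta> * x) * d) / sqrt 2) =
      (x * x * (a * c) + (\<theta> * (x * x)) * (a * d) + (\<theta> * (x * x)) * (b * c)
        + (\<theta> * (\<theta> * (x * x))) * (b * d)) / 2" for x a b c d :: real
    proof -
      have "p / sqrt 2 * (q / sqrt 2) = p * q / 2" for p q :: real by simp
      moreover have "(x * a + (\<theta> * x) * b) * (x * c + (\<theta> * x) * d) =
          x * x * (a * c) + (\<theta> * (x * x)) * (a * d) + (\<theta> * (x * x)) * (b * c)
          + (\<theta> * (\<theta> * (x * x))) * (b * d)" by algebra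
      ultimately show ?thesis by metis
    qed
    have even: "\<theta> ^ (2 * m) = \<theta> ^ m * \<theta> ^ m" unfolding mult_2 by (rule power_add)
    have odd: "\<theta> ^ (2 * m + 1) = \<theta> * (\<theta> ^ m * \<theta> ^ m)"
      "\<theta> ^ (2 * m + 2) = \<theta> * (\<theta> * (\<theta> ^ m * \<theta> ^ m))"
      unfolding even[symmetric] by simp_all
    show ?thesis
      unfolding noise_coeff_def nat.case even odd power_Suc by (rule expand)
  qed
  have "(\<Sum>k\<in>?B. noise_coeff \<theta> (Suc m) i k * noise_coeff \<theta> (Suc m) j k) =
      (\<theta> ^ (2 * m) * (\<Sum>k\<in>?B. path_count m i k * path_count m j k)
       + \<theta> ^ (2 * m + 1) * (\<Sum>k\<in>?B. path_count m i k * path_count (Suc m) j k)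
       + \<theta> ^ (2 * m + 1) * (\<Sum>k\<in>?B. path_count (Suc m) i k * path_count m j k)
       + \<theta> ^ (2 * m + 2) * (\<Sum>k\<in>?B. path_count (Suc m) i k * path_count (Suc m) j k)) / 2"
    unfolding prod sum_divide_distrib[symmetric] sum.distrib sum_distrib_left[symmetric] ..
  also have "\<dots> = (\<theta> ^ (2 * m) * path_count (m + m) i j
       + \<theta> ^ (2 * m + 1) * path_count (m + Suc m) i j
       + \<theta> ^ (2 * m + 1) * path_count (Suc m + m) i j
       + \<theta> ^ (2 * m + 2) * path_count (Suc m + Suc m) i j) / 2"
    using conc[of m] conc[of "Suc m"] by simp
  finally show ?thesis
    unfolding len by simp
qed

text \<open>Each new layer supplies the missing half of the term of order \<open>2 * n\<close>, the whole next
  term, and half of the one after it. In the limit, only the covariance series remains.\<close>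

lemma truncated_cov_Suc:
  "truncated_cov \<theta> (Suc n) i j =
     (\<Sum>k<2 * n. \<theta> ^ k * path_count k i j) + \<theta> ^ (2 * n) * path_count (2 * n) i j / 2"
proof (induction n)
  case 0
  show ?case
    by (auto simp: truncated_cov_def noise_coeff_def path_count_0)
next
  case (Suc n)
  have "truncated_cov \<theta> (Suc (Suc n)) i j = truncated_cov \<theta> (Suc n) i j +
      (\<Sum>k\<in>l1_ball (Suc n) i. noise_coeff \<theta> (Suc n) i k * noise_coeff \<theta> (Suc n) j k)"
    by (simp add: truncated_cov_def)
  then show ?case unfolding Suc.IH noise_layer_cov_Suc
    by (simp add: add_divide_distrib)
qed

lemma summable_path_count:
  fixes i j :: "int ^ 'd"
  assumes "\<bar>\<theta>\<bar> * lattice_degree TYPE('d) < 1"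
  shows "summable (\<lambda>k. \<theta> ^ k * path_count k i j)"
proof (rule summable_comparison_test')
  show "summable (\<lambda>k. (\<bar>\<theta>\<bar> * lattice_degree TYPE('d)) ^ k)"
    using assms by (intro summable_geometric) simp
  show "norm (\<theta> ^ k * path_count k i j) \<le> (\<bar>\<theta>\<bar> * lattice_degree TYPE('d)) ^ k" if "0 \<le> k" for k
    using path_count_le[of k i j]
    by (simp add: abs_mult power_abs power_mult_distrib mult_left_mono)
qed

lemma truncated_cov_limit:
  fixes i j :: "int ^ 'd"
  assumes "\<bar>\<theta>\<bar> * lattice_degree TYPE('d) < 1"
  shows "(\<lambda>n. truncated_cov \<theta> n i j) \<longlonglongrightarrow> (\<Sum>k. \<theta> ^ k * path_count k i j)"
proof (rule LIMSEQ_imp_Suc)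
  note s = summable_path_count[OF assms, of i j]
  have even: "filterlim (\<lambda>n::nat. 2 * n) sequentially sequentially"
    by (rule filterlim_subseq) (auto intro: strict_monoI)
  have "(\<lambda>n. \<Sum>k<2 * n. \<theta> ^ k * path_count k i j) \<longlonglongrightarrow> (\<Sum>k. \<theta> ^ k * path_count k i j)"
    using filterlim_compose[OF summable_LIMSEQ[OF s] even] .
  moreover have "(\<lambda>n. \<theta> ^ (2 * n) * path_count (2 * n) i j) \<longlonglongrightarrow> 0"
    using filterlim_compose[OF summable_LIMSEQ_zero[OF s] even] .
  then have "(\<lambda>n. \<theta> ^ (2 * n) * path_count (2 * n) i j / 2) \<longlonglongrightarrow> 0"
    by (rule tendsto_divide_zero)
  ultimately show "(\<lambda>n. truncated_cov \<theta> (Suc n) i j) \<longlonglongrightarrow> (\<Sum>k. \<theta> ^ k * path_count k i j)"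
    unfolding truncated_cov_Suc using tendsto_add by fastforce
qed

lemma sum_noise_coeff_le:
  fixes i :: "int ^ 'd" and \<theta> :: real
  defines "r \<equiv> \<bar>\<theta>\<bar> * lattice_degree TYPE('d)"
  shows "(\<Sum>j\<in>l1_ball (Suc m) i. \<bar>noise_coeff \<theta> (Suc m) i j\<bar>) \<le> (1 + r) * r ^ m / sqrt 2"
proof -
  let ?B = "l1_ball (Suc m) i"
  have "\<bar>noise_coeff \<theta> (Suc m) i j\<bar> \<le>
      (\<bar>\<theta>\<bar> ^ m * path_count m i j + \<bar>\<theta>\<bar> ^ Suc m * path_count (Suc m) i j) / sqrt 2" for j
    unfolding noise_coeff_def abs_divide
    by (auto intro!: divide_right_mono order.trans[OF abs_triangle_ineq] simp: abs_mult power_abs)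
  then have "(\<Sum>j\<in>?B. \<bar>noise_coeff \<theta> (Suc m) i j\<bar>) \<le>
      (\<Sum>j\<in>?B. (\<bar>\<theta>\<bar> ^ m * path_count m i j + \<bar>\<theta>\<bar> ^ Suc m * path_count (Suc m) i j) / sqrt 2)"
    by (intro sum_mono)
  also have "\<dots> = (\<bar>\<theta>\<bar> ^ m * (\<Sum>j\<in>?B. path_count m i j)
      + \<bar>\<theta>\<bar> ^ Suc m * (\<Sum>j\<in>?B. path_count (Suc m) i j)) / sqrt 2"
    by (simp only: sum.distrib sum_divide_distrib[symmetric] sum_distrib_left)
  also have "\<dots> \<le> (\<bar>\<theta>\<bar> ^ m * lattice_degree TYPE('d) ^ m + \<bar>\<theta>\<bar> ^ Suc m * lattice_degree TYPE('d) ^ Suc m) / sqrt 2"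
    by (intro divide_right_mono add_mono mult_left_mono sum_path_count_le) auto
  also have "\<dots> = (1 + r) * r ^ m / sqrt 2"
    by (simp add: r_def power_mult_distrib algebra_simps)
  finally show ?thesis .
qed

section \<open>Total variation under a change of shift, and local functions of noise\<close>

lemma normal_density_le_half: "normal_density a 1 x \<le> 1 / 2"
proof -
  have "2 \<le> sqrt (2 * pi)" using pi_ge_two by (intro real_le_rsqrt) simp
  then have "1 / sqrt (2 * pi) \<le> 1 / 2" by (intro divide_left_mono) auto
  moreover have "exp (- (x - a)\<^sup>2 / 2) \<le> 1" by simp
  ultimately have "1 / sqrt (2 * pi) * exp (- (x - a)\<^sup>2 / 2) \<le> 1 / 2 * 1"
    by (intro mult_mono) auto
  then show ?thesis by (simp add: normal_density_def)
qed

lemma measure_shifted_std_normal: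
  assumes [measurable]: "B \<in> sets borel"
  shows "measure std_normal_distribution {x. x + a \<in> B} =
    (\<integral>u. indicator B u * normal_density a 1 u \<partial>lborel)"
proof -
  have "measure std_normal_distribution {x. x + a \<in> B} =
      measure (distr std_normal_distribution borel (\<lambda>x. x + a)) B"
    by (subst measure_distr) (auto simp: vimage_def)
  also have "\<dots> = (\<integral>u. indicator B u \<partial>density lborel (normal_density a 1))"
    using distr_affine_std_normal[of 1 a] by (simp add: add.commute)
  also have "\<dots> = (\<integral>u. normal_density a 1 u *\<^sub>R indicator B u \<partial>lborel)"
    by (subst integral_density) auto
  finally show ?thesis by (simp add: mult.commute)
qed

text \<open>The density centered at \<open>a\<close> dominates the one centered at \<open>b\<close> to the left of the midpoint and
  is dominated by it to the right, so
  the worst set is a half-line. For it, the difference is the mass that the normal law gives to an interval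
  of length \<open>b - a\<close>, and the density is at most \<open>1/2\<close>.\<close>

lemma shifted_std_normal_diff_le:
  assumes B [measurable]: "B \<in> sets borel" and ab: "a \<le> b"
  shows "measure std_normal_distribution {x. x + a \<in> B} -
    measure std_normal_distribution {x. x + b \<in> B} \<le> (b - a) / 2"
proof -
  let ?N = std_normal_distribution
  interpret prob_space ?N by (rule prob_space_std_normal)
  define m h where "m = (a + b) / 2" and "h = (b - a) / 2"
  have int: "integrable lborel (\<lambda>u. indicator C u * normal_density c 1 u)"
    if "C \<in> sets borel" for C and c :: real
    using integrable_mult_indicator[of C lborel "normal_density c 1"] that by simp
  have le_iff: "normal_density c 1 u \<le> normal_density c' 1 u \<longleftrightarrow> (u - c')\<^sup>2 \<le> (u - c)\<^sup>2" for c c' u :: real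
    by (simp add: normal_density_def divide_le_cancel)
  have sq: "(u - b)\<^sup>2 - (u - a)\<^sup>2 = 2 * ((b - a) * (m - u))" for u
    by (simp add: m_def power2_eq_square field_simps)
  have left: "normal_density b 1 u \<le> normal_density a 1 u" if "u \<le> m" for u
    using sq[of u] mult_nonneg_nonneg[of "b - a" "m - u"] ab that unfolding le_iff by linarith
  have right: "normal_density a 1 u \<le> normal_density b 1 u" if "\<not> u \<le> m" for u
    using sq[of u] mult_nonneg_nonpos[of "b - a" "m - u"] ab that unfolding le_iff by linarith
  have h: "0 \<le> h" using ab by (simp add: h_def)
  have half_line: "{..m} \<in> sets borel" by simp
  have "measure ?N {x. x + a \<in> B} - measure ?N {x. x + b \<in> B} =
      (\<integral>u. indicator B u * normal_density a 1 u - indicator B u * normal_density b 1 u \<partial>lborel)"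
    unfolding measure_shifted_std_normal[OF B]
    by (rule Bochner_Integration.integral_diff[symmetric]) (intro int B)+
  also have "\<dots> \<le> (\<integral>u. indicator {..m} u * normal_density a 1 u - indicator {..m} u * normal_density b 1 u \<partial>lborel)"
    using left right
    by (intro integral_mono Bochner_Integration.integrable_diff int B) (auto simp: indicator_def)
  also have "\<dots> = measure ?N {x. x + a \<in> {..m}} - measure ?N {x. x + b \<in> {..m}}"
    unfolding measure_shifted_std_normal[OF half_line]
    by (rule Bochner_Integration.integral_diff) (intro int half_line)+
  also have "{x. x + a \<in> {..m}} = {..h}" by (auto simp: m_def h_def field_simps)
  also have "{x. x + b \<in> {..m}} = {..-h}" by (auto simp: m_def h_def field_simps)
  also have "measure ?N {..h} - measure ?N {..-h} = measure ?N {-h<..h}"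
  proof -
    have "{..h} - {..-h} = {-h<..h}" "{..-h} \<subseteq> {..h}" using ab by (auto simp: h_def field_simps)
    then show ?thesis using finite_measure_Diff[of "{..h}" "{..-h}"] by simp
  qed
  also have "\<dots> \<le> h"
  proof -
    have "emeasure ?N {-h<..h} = (\<integral>\<^sup>+x. ennreal (std_normal_density x) * indicator {-h<..h} x \<partial>lborel)"
      by (rule emeasure_density) auto
    also have "\<dots> \<le> (\<integral>\<^sup>+x. ennreal (1 / 2) * indicator {-h<..h} x \<partial>lborel)"
      by (intro nn_integral_mono mult_right_mono ennreal_leI normal_density_le_half) simp
    also have "\<dots> = ennreal (1 / 2) * emeasure lborel {-h<..h}"
      by (rule nn_integral_cmult_indicator) simp
    also have "\<dots> = ennreal (1 / 2) * ennreal (2 * h)"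
      using h by simp
    also have "\<dots> = ennreal h"
      using h by (subst ennreal_mult[symmetric]) auto
    finally show ?thesis
      using h by (simp add: emeasure_eq_measure)
  qed
  finally show ?thesis by (simp add: h_def)
qed

lemma shifted_std_normal_tv:
  assumes B [measurable]: "B \<in> sets borel"
  shows "\<bar>measure std_normal_distribution {x. x + a \<in> B} -
    measure std_normal_distribution {x. x + b \<in> B}\<bar> \<le> \<bar>a - b\<bar> / 2"
proof -
  let ?N = std_normal_distribution
  interpret prob_space ?N by (rule prob_space_std_normal)
  have B': "- B \<in> sets borel" using B by (simp add: borel_comp)
  have compl: "measure ?N {x. x + c \<in> - B} = 1 - measure ?N {x. x + c \<in> B}" for c
  proof -
    have "{x. x + c \<in> B} \<in> sets borel"
      using measurable_sets[of "\<lambda>x. x + c" borel borel B] B by (simp add: vimage_def)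
    moreover have "{x. x + c \<in> - B} = space ?N - {x. x + c \<in> B}" by auto
    ultimately show ?thesis using prob_compl[of "{x. x + c \<in> B}"] by simp
  qed
  have *: "\<bar>measure ?N {x. x + a \<in> B} - measure ?N {x. x + b \<in> B}\<bar> \<le> (b - a) / 2"
    if "a \<le> b" for a b
    using shifted_std_normal_diff_le[OF B that] shifted_std_normal_diff_le[OF B' that]
    unfolding compl by linarith
  show ?thesis using *[of a b] *[of b a] by (cases "a \<le> b") (auto simp: abs_minus_commute)
qed

lemma scaled_std_normal_tv:
  assumes B: "B \<in> sets borel" and s: "0 < s"
  shows "\<bar>measure std_normal_distribution {x. s * x + a \<in> B} -
    measure std_normal_distribution {x. s * x + b \<in> B}\<bar> \<le> \<bar>a - b\<bar> / (2 * s)"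
proof -
  define C where "C = (\<lambda>y. s * y) -` B"
  have "C \<in> sets borel"
    unfolding C_def using measurable_sets[of "\<lambda>y. s * y" borel borel B] B by simp
  moreover have "{x. s * x + c \<in> B} = {x. x + c / s \<in> C}" for c
    using s by (simp add: C_def distrib_left)
  moreover have "\<bar>a / s - b / s\<bar> / 2 = \<bar>a - b\<bar> / (2 * s)"
    using s by (simp add: diff_divide_distrib[symmetric] abs_divide)
  ultimately show ?thesis using shifted_std_normal_tv[of C "a / s" "b / s"] by simp
qed

text \<open>One coordinate of a product measure may be drawn afresh, independently of all others.\<close>

lemma PiM_resample:
  fixes f :: "('k \<Rightarrow> 'b) \<Rightarrow> real"
  assumes N: "prob_space N" and f [measurable]: "f \<in> borel_measurable (PiM UNIV (\<lambda>_. N))"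
    and bound: "\<And>w. \<bar>f w\<bar> \<le> C"
  shows "(\<integral>w. f w \<partial>PiM UNIV (\<lambda>_. N)) = (\<integral>w. (\<integral>x. f (w(k := x)) \<partial>N) \<partial>PiM UNIV (\<lambda>_. N))"
proof -
  let ?P = "PiM UNIV (\<lambda>_ :: 'k. N)"
  interpret N: prob_space N by fact
  interpret P: prob_space ?P by (intro prob_space_PiM N)
  interpret pair: pair_prob_space N ?P ..
  have upd [measurable]: "(\<lambda>(x, w). w(k := x)) \<in> measurable (N \<Otimes>\<^sub>M ?P) ?P"
    unfolding split_beta' by (rule measurable_fun_upd[where J = UNIV]) auto
  have law: "distr (N \<Otimes>\<^sub>M ?P) ?P (\<lambda>(x, w). w(k := x)) = ?P"
    using distr_pair_PiM_eq_PiM[of UNIV "\<lambda>_. N" k] N by simp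
  have "(\<integral>w. f w \<partial>?P) = (\<integral>w. f w \<partial>distr (N \<Otimes>\<^sub>M ?P) ?P (\<lambda>(x, w). w(k := x)))"
    by (simp only: law)
  also have "\<dots> = (\<integral>p. f ((\<lambda>(x, w). w(k := x)) p) \<partial>(N \<Otimes>\<^sub>M ?P))"
    by (rule integral_distr[OF upd f])
  also have "\<dots> = (\<integral>(x, w). f (w(k := x)) \<partial>(N \<Otimes>\<^sub>M ?P))"
    by (simp add: split_beta')
  also have "\<dots> = (\<integral>w. (\<integral>x. f (w(k := x)) \<partial>N) \<partial>?P)"
  proof (rule pair.integral_snd[symmetric])
    have "(\<lambda>p. f ((\<lambda>(x, w). w(k := x)) p)) \<in> borel_measurable (N \<Otimes>\<^sub>M ?P)"
      by measurable
    then show "integrable (N \<Otimes>\<^sub>M ?P) (\<lambda>(x, w). f (w(k := x)))"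
      using bound by (intro pair.P.integrable_const_bound[of _ C]) (auto simp: split_beta')
  qed
  finally show ?thesis .
qed

text \<open>The coordinates \<open>e i\<close> carry the smoothing noise. A hybrid argument changes the shift from \<open>V\<close> to \<open>V'\<close>
  at one site after the other. When site \<open>k\<close> is changed, the coordinate \<open>e k\<close> is drawn afresh while
  everything else is kept: both shifts ignore this coordinate, so what remains is to compare two
  translates of one normal law on the line.\<close>

lemma replace_shift_tv:
  fixes V V' :: "('k \<Rightarrow> real) \<Rightarrow> 'i \<Rightarrow> real"
  defines "\<Omega> \<equiv> PiM UNIV (\<lambda>_ :: 'k. std_normal_distribution)"
  assumes e: "inj e" and s: "0 < s" and fin: "finite \<Lambda>"
    and V: "\<And>i. (\<lambda>w. V w i) \<in> borel_measurable \<Omega>" and V': "\<And>i. (\<lambda>w. V' w i) \<in> borel_measurable \<Omega>"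
    and V_upd: "\<And>w k x i. V (w(e k := x)) i = V w i" and V'_upd: "\<And>w k x i. V' (w(e k := x)) i = V' w i"
    and int: "\<And>i. integrable \<Omega> (\<lambda>w. \<bar>V w i - V' w i\<bar>)"
    and Q: "Q \<in> sets (PiM \<Lambda> (\<lambda>_. borel))"
  shows "\<bar>measure \<Omega> {w. (\<lambda>i\<in>\<Lambda>. s * w (e i) + V w i) \<in> Q} -
     measure \<Omega> {w. (\<lambda>i\<in>\<Lambda>. s * w (e i) + V' w i) \<in> Q}\<bar>
     \<le> (\<Sum>i\<in>\<Lambda>. (\<integral>w. \<bar>V w i - V' w i\<bar> \<partial>\<Omega>) / (2 * s))"
proof -
  let ?N = std_normal_distribution
  interpret N: prob_space ?N by (rule prob_space_std_normal)
  interpret \<Omega>: prob_space \<Omega>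
    unfolding \<Omega>_def by (intro prob_space_PiM prob_space_std_normal)
  have space: "space \<Omega> = UNIV" by (simp add: \<Omega>_def space_PiM)
  note [measurable] = V V' Q
  have coord [measurable]: "(\<lambda>w. w k) \<in> borel_measurable \<Omega>" for k
    unfolding \<Omega>_def using measurable_component_singleton[of k UNIV "\<lambda>_. ?N"]
    by (simp cong: measurable_cong_sets)
  define H where "H U w = (\<lambda>i\<in>\<Lambda>. s * w (e i) + (if i \<in> U then V' w i else V w i))" for U w
  have H [measurable]: "H U \<in> measurable \<Omega> (PiM \<Lambda> (\<lambda>_. borel))" for U
    unfolding H_def[abs_def] by (intro measurable_restrict) auto
  define p where "p U = measure \<Omega> {w. H U w \<in> Q}" for U
  have p_int: "p U = (\<integral>w. (\<integral>x. indicator Q (H U (w(k := x))) \<partial>?N) \<partial>\<Omega>)" for U k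
  proof -
    have meas: "(\<lambda>w. indicator Q (H U w) :: real) \<in> borel_measurable \<Omega>" by measurable
    have "p U = (\<integral>w. indicator {w. H U w \<in> Q} w \<partial>\<Omega>)"
      by (simp add: p_def space)
    also have "\<dots> = (\<integral>w. indicator Q (H U w) \<partial>\<Omega>)"
      by (intro Bochner_Integration.integral_cong) (auto simp: indicator_def)
    also have "\<dots> = (\<integral>w. (\<integral>x. indicator Q (H U (w(k := x))) \<partial>?N) \<partial>\<Omega>)"
      unfolding \<Omega>_def
      by (rule PiM_resample[OF prob_space_std_normal, of _ 1]) (use meas in \<open>auto simp: \<Omega>_def indicator_def\<close>)
    finally show ?thesis .
  qed
  have step: "\<bar>p U - p (insert k U)\<bar> \<le> (\<integral>w. \<bar>V w k - V' w k\<bar> \<partial>\<Omega>) / (2 * s)"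
    if k: "k \<in> \<Lambda>" "k \<notin> U" for k U
  proof -
    define I :: "'i set \<Rightarrow> ('k \<Rightarrow> real) \<Rightarrow> real"
      where "I U w = (\<integral>x. indicator Q (H U (w(e k := x))) \<partial>?N)" for U w
    have upd [measurable]: "(\<lambda>q. (fst q)(e k := snd q)) \<in> measurable (\<Omega> \<Otimes>\<^sub>M ?N) \<Omega>"
      unfolding \<Omega>_def by (rule measurable_fun_upd[where J = UNIV]) auto
    have I_meas [measurable]: "I U \<in> borel_measurable \<Omega>" for U
      unfolding I_def by (rule N.borel_measurable_lebesgue_integral) (simp add: split_beta')
    have I_bound: "\<bar>I U w\<bar> \<le> 1" for U w
    proof -
      have "0 \<le> I U w" unfolding I_def by (rule Bochner_Integration.integral_nonneg) simp
      moreover have "I U w \<le> (\<integral>x. 1 \<partial>?N)"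
        unfolding I_def by (rule integral_mono') (auto simp: indicator_def)
      ultimately show ?thesis by (simp add: N.prob_space[simplified])
    qed
    have I_int: "integrable \<Omega> (I U)" for U
      using I_bound by (intro \<Omega>.integrable_const_bound[of _ 1]) auto
    have I_diff: "\<bar>I U w - I (insert k U) w\<bar> \<le> \<bar>V w k - V' w k\<bar> / (2 * s)" for w
    proof -
      \<comment> \<open>The section of the event along site \<open>k\<close>, the values at the other sites being frozen.\<close>
      define B where "B = {y. (H U w)(k := y) \<in> Q}"
      have "(\<lambda>y. (H U w)(k := y)) \<in> measurable borel (PiM \<Lambda> (\<lambda>_. borel))"
      proof (rule measurable_PiM_single')
        show "(\<lambda>y. ((H U w)(k := y)) i) \<in> borel_measurable borel" for i
          by (cases "i = k") auto
      qed (use k in \<open>auto simp: H_def PiE_iff extensional_def\<close>)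
      then have B: "B \<in> sets borel"
        using measurable_sets[OF _ Q] by (simp add: B_def vimage_def)
      have *: "H U (w(e k := x)) = (H U w)(k := s * x + V w k)"
          "H (insert k U) (w(e k := x)) = (H U w)(k := s * x + V' w k)" for x
        using k e by (auto simp: H_def fun_eq_iff V_upd V'_upd inj_eq)
      have "(\<integral>x. indicator Q ((H U w)(k := s * x + c)) \<partial>?N) = measure ?N {x. s * x + c \<in> B}" for c
      proof -
        have "(\<integral>x. indicator Q ((H U w)(k := s * x + c)) \<partial>?N) =
            (\<integral>x. (indicator {x. s * x + c \<in> B} x :: real) \<partial>?N)"
          by (intro Bochner_Integration.integral_cong) (auto simp: B_def indicator_def)
        then show ?thesis by simp
      qed
      then have "I U w = measure ?N {x. s * x + V w k \<in> B}"
        "I (insert k U) w = measure ?N {x. s * x + V' w k \<in> B}"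
        by (simp_all add: I_def *)
      then show ?thesis using scaled_std_normal_tv[OF B s] by simp
    qed
    have "\<bar>p U - p (insert k U)\<bar> = \<bar>\<integral>w. I U w - I (insert k U) w \<partial>\<Omega>\<bar>"
      unfolding p_int[of _ "e k"] I_def[symmetric] using I_int by simp
    also have "\<dots> \<le> (\<integral>w. \<bar>I U w - I (insert k U) w\<bar> \<partial>\<Omega>)"
      by (rule integral_abs_bound)
    also have "\<dots> \<le> (\<integral>w. \<bar>V w k - V' w k\<bar> / (2 * s) \<partial>\<Omega>)"
      using I_int int by (intro integral_mono I_diff) auto
    finally show ?thesis by simp
  qed
  have "\<bar>p {} - p U\<bar> \<le> (\<Sum>i\<in>U. (\<integral>w. \<bar>V w i - V' w i\<bar> \<partial>\<Omega>) / (2 * s))" if "U \<subseteq> \<Lambda>" for U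
    using finite_subset[OF that fin] that
  proof (induction U rule: finite_induct)
    case (insert k U)
    then show ?case using step[of k U] by simp
  qed simp
  from this[OF order_refl] show ?thesis
    by (simp add: p_def H_def cong: restrict_cong if_cong)
qed

text \<open>Restrictions of \<open>F\<close> to two distant sets are functions of disjoint families of independent coordinates.\<close>

lemma l_dependent_local_function:
  fixes F :: "('k \<Rightarrow> real) \<Rightarrow> int ^ 'd \<Rightarrow> real" and dep :: "int ^ 'd \<Rightarrow> 'k set"
  defines "\<Omega> \<equiv> PiM UNIV (\<lambda>_ :: 'k. std_normal_distribution)"
  assumes F: "F \<in> measurable \<Omega> (config_space UNIV)"
    and local: "\<And>i w w'. (\<And>k. k \<in> dep i \<Longrightarrow> w k = w' k) \<Longrightarrow> F w i = F w' i"
    and disjoint: "\<And>i j. l1_dist i j > int l \<Longrightarrow> dep i \<inter> dep j = {}"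
  shows "l_dependent l (distr \<Omega> (config_space UNIV) F)"
proof -
  let ?N = std_normal_distribution
  interpret P: product_prob_space "\<lambda>_ :: 'k. ?N" UNIV
    by (intro product_prob_spaceI prob_space_std_normal)
  interpret \<Omega>: prob_space \<Omega>
    unfolding \<Omega>_def by (rule P.prob_space_axioms)
  let ?\<nu> = "distr \<Omega> (config_space UNIV) F"
  interpret \<nu>: prob_space ?\<nu> by (rule \<Omega>.prob_space_distr[OF F])
  have res [measurable]: "(\<lambda>\<xi>. restrict \<xi> A) \<in> measurable (config_space UNIV) (config_space A)"
    for A :: "(int ^ 'd) set" by (rule measurable_restrict_subset) simp
  have "\<nu>.indep_var (config_space A) (\<lambda>\<xi>. restrict \<xi> A) (config_space A') (\<lambda>\<xi>. restrict \<xi> A')"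
    if far: "\<forall>i\<in>A. \<forall>j\<in>A'. l1_dist i j > int l" for A A'
  proof -
    define D where "D C = (\<Union>i\<in>C. dep i)" for C
    \<comment> \<open>Coordinates outside \<open>D C\<close> do not influence \<open>F\<close> on \<open>C\<close>, so any value, here \<open>0\<close>, may be put there.\<close>
    define ext where "ext C v = (\<lambda>k. if k \<in> D C then v k else 0)" for C and v :: "'k \<Rightarrow> real"
    have ext: "ext C \<in> measurable (PiM (D C) (\<lambda>_. ?N)) \<Omega>" for C
      unfolding \<Omega>_def ext_def[abs_def]
    proof (rule measurable_PiM_single')
      fix k show "(\<lambda>v. if k \<in> D C then v k else 0) \<in> measurable (PiM (D C) (\<lambda>_. ?N)) ?N"
        by (cases "k \<in> D C") auto
    qed (auto simp: PiE_def)
    have G: "(\<lambda>v. restrict (F (ext C v)) C) \<in> measurable (PiM (D C) (\<lambda>_. ?N)) (config_space C)" for C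
      using measurable_compose[OF ext measurable_compose[OF F res]] .
    have factor: "restrict (F (ext C (restrict w (D C)))) C = restrict (F w) C" for C w
    proof
      fix i show "restrict (F (ext C (restrict w (D C)))) C i = restrict (F w) C i"
      proof (cases "i \<in> C")
        case True
        then have "F (ext C (restrict w (D C))) i = F w i"
          by (intro local) (auto simp: ext_def D_def)
        then show ?thesis using True by simp
      qed simp
    qed
    have "\<Omega>.indep_vars (\<lambda>_. ?N) (\<lambda>k w. w k) UNIV"
      unfolding \<Omega>_def using P.PiM_component by (subst P.indep_vars_iff_distr_eq_PiM') (auto simp: restrict_UNIV)
    moreover have "D A \<inter> D A' = {}" using far disjoint by (fastforce simp: D_def)
    ultimately have "\<Omega>.indep_var (PiM (D A) (\<lambda>_. ?N)) (\<lambda>w. restrict w (D A))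
        (PiM (D A') (\<lambda>_. ?N)) (\<lambda>w. restrict w (D A'))"
      using \<Omega>.indep_var_restrict[of "\<lambda>_. ?N" "\<lambda>k w. w k" UNIV "D A" "D A'"] by simp
    from \<Omega>.indep_var_compose[OF this G G]
    have "\<Omega>.indep_var (config_space A) (\<lambda>w. restrict (F w) A) (config_space A') (\<lambda>w. restrict (F w) A')"
      by (simp add: comp_def factor)
    then have eq: "distr \<Omega> (config_space A) (\<lambda>w. restrict (F w) A) \<Otimes>\<^sub>M distr \<Omega> (config_space A') (\<lambda>w. restrict (F w) A')
        = distr \<Omega> (config_space A \<Otimes>\<^sub>M config_space A') (\<lambda>w. (restrict (F w) A, restrict (F w) A'))"
      by (simp add: \<Omega>.indep_var_distribution_eq)
    show ?thesis
      unfolding \<nu>.indep_var_distribution_eq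
      using eq F by (auto simp: distr_distr comp_def)
  qed
  then show ?thesis
    unfolding l_dependent_def using \<nu>.prob_space_axioms by simp
qed

section \<open>The field as a series of white noises\<close>

text \<open>The coordinate \<open>(i, n)\<close> is the noise of layer \<open>n\<close> at site \<open>i\<close>.\<close>

abbreviation white_noise :: "((int ^ 'd::finite) \<times> nat \<Rightarrow> real) measure" where
  "white_noise \<equiv> PiM UNIV (\<lambda>_. std_normal_distribution)"

definition noise_layer :: "real \<Rightarrow> nat \<Rightarrow> ((int ^ 'd::finite) \<times> nat \<Rightarrow> real) \<Rightarrow> int ^ 'd \<Rightarrow> real" where
  "noise_layer \<theta> n w i = (\<Sum>j\<in>l1_ball n i. noise_coeff \<theta> n i j * w (j, n))"

definition truncated_field :: "real \<Rightarrow> nat \<Rightarrow> ((int ^ 'd::finite) \<times> nat \<Rightarrow> real) \<Rightarrow> int ^ 'd \<Rightarrow> real" where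
  "truncated_field \<theta> n w i = (\<Sum>m<n. noise_layer \<theta> m w i)"

definition smooth_part :: "real \<Rightarrow> ((int ^ 'd::finite) \<times> nat \<Rightarrow> real) \<Rightarrow> int ^ 'd \<Rightarrow> real" where
  "smooth_part \<theta> w i = (\<Sum>m. noise_layer \<theta> (Suc m) w i)"

text \<open>The layer \<open>0\<close> is split off so that the decomposition into a fresh noise at the site and a smooth part
  that ignores it holds at every point, also where the series diverges and \<open>suminf\<close> has an arbitrary value.\<close>

definition full_field :: "real \<Rightarrow> ((int ^ 'd::finite) \<times> nat \<Rightarrow> real) \<Rightarrow> int ^ 'd \<Rightarrow> real" where
  "full_field \<theta> w i = 1 / sqrt 2 * w (i, 0) + smooth_part \<theta> w i"

lemma noise_layer_0: "noise_layer \<theta> 0 w i = 1 / sqrt 2 * w (i, 0)"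
  by (simp add: noise_layer_def noise_coeff_def)

lemma full_field_eq_suminf:
  assumes "summable (\<lambda>m. noise_layer \<theta> m w i)"
  shows "full_field \<theta> w i = (\<Sum>m. noise_layer \<theta> m w i)"
  using suminf_split_head[OF assms] by (simp add: full_field_def smooth_part_def noise_layer_0)

lemma truncated_field_Suc:
  "truncated_field \<theta> (Suc q) w i = 1 / sqrt 2 * w (i, 0) + (\<Sum>m<q. noise_layer \<theta> (Suc m) w i)"
  unfolding truncated_field_def sum.lessThan_Suc_shift noise_layer_0 ..

lemma measurable_white_noise_coordinate [measurable]:
  "(\<lambda>w. w k) \<in> borel_measurable white_noise"
  using measurable_component_singleton[of k UNIV "\<lambda>_. std_normal_distribution"]
  by (simp cong: measurable_cong_sets)

lemma measurable_noise_layer [measurable]: "(\<lambda>w. noise_layer \<theta> n w i) \<in> borel_measurable white_noise"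
  unfolding noise_layer_def by measurable

lemma measurable_truncated_field [measurable]:
  "(\<lambda>w. truncated_field \<theta> n w i) \<in> borel_measurable white_noise"
  unfolding truncated_field_def by measurable

lemma measurable_smooth_part [measurable]: "(\<lambda>w. smooth_part \<theta> w i) \<in> borel_measurable white_noise"
  unfolding smooth_part_def by measurable

lemma measurable_full_field [measurable]: "(\<lambda>w. full_field \<theta> w i) \<in> borel_measurable white_noise"
  unfolding full_field_def by measurable

lemma measurable_into_config_space:
  assumes "\<And>i. (\<lambda>w. F w i) \<in> borel_measurable M"
  shows "F \<in> measurable M (config_space UNIV)"
  using measurable_PiM_single'[of UNIV "\<lambda>i w. F w i" M "\<lambda>_. borel"] assms by simp

lemma jointly_gaussian_truncated_field:
  "jointly_gaussian white_noise (\<lambda>i w. truncated_field \<theta> n w i) (truncated_cov \<theta> n)"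
proof (rule jointly_gaussian_linear_image[OF jointly_gaussian_iid_coordinates,
      where S = "\<lambda>i. (\<lambda>(m, j). (j, m)) ` (SIGMA m:{..<n}. l1_ball m i)"
        and h = "\<lambda>i (j, m). noise_coeff \<theta> m i j"])
  have inj: "inj_on (\<lambda>(m, j). (j, m)) A" for A :: "(nat \<times> (int ^ 'a)) set"
    by (auto simp: inj_on_def)
  show "finite ((\<lambda>(m, j). (j, m)) ` (SIGMA m:{..<n}. l1_ball m i))" for i :: "int ^ 'a"
    by (intro finite_imageI finite_SigmaI) auto
  show "truncated_field \<theta> n w i = (\<Sum>k\<in>(\<lambda>(m, j). (j, m)) ` (SIGMA m:{..<n}. l1_ball m i).
      (case k of (j, m) \<Rightarrow> noise_coeff \<theta> m i j) * w k)" for i :: "int ^ 'a" and w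
    unfolding sum.reindex[OF inj] truncated_field_def noise_layer_def
    by (subst sum.Sigma) (auto intro!: sum.cong)
  fix i j :: "int ^ 'a"
  let ?S = "\<lambda>i. (\<lambda>(m, j). (j, m)) ` (SIGMA m:{..<n}. l1_ball m i)"
  let ?h = "\<lambda>i (j, m). noise_coeff \<theta> m i j"
  have fin: "finite (?S j)" by (intro finite_imageI finite_SigmaI) auto
  have inner: "(\<Sum>l\<in>?S j. ?h i k * ?h j l * (if k = l then 1 else 0)) = ?h i k * ?h j k"
    if "k \<in> ?S i" for k
  proof (cases "k \<in> ?S j")
    case True
    then show ?thesis using fin
      by (simp add: if_distrib[of "\<lambda>c. _ * c"] sum.delta cong: if_cong)
  next
    case False
    then have "snd k < n \<longrightarrow> fst k \<notin> l1_ball (snd k) j"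
      by (cases k) (auto simp: image_iff)
    then have "?h j k = 0" using that by (cases k) (auto simp: noise_coeff_eq_0)
    then show ?thesis by (auto intro!: sum.neutral)
  qed
  have "(\<Sum>k\<in>?S i. \<Sum>l\<in>?S j. ?h i k * ?h j l * (if k = l then 1 else 0)) = (\<Sum>k\<in>?S i. ?h i k * ?h j k)"
    by (intro sum.cong inner refl)
  also have "\<dots> = truncated_cov \<theta> n i j"
    unfolding sum.reindex[OF inj] truncated_cov_def
    by (subst sum.Sigma) (auto intro!: sum.cong)
  finally show "truncated_cov \<theta> n i j = (\<Sum>k\<in>?S i. \<Sum>l\<in>?S j. ?h i k * ?h j l * (if k = l then 1 else 0))"
    by (rule sym)
qed

lemma nn_integral_abs_coordinate_le:
  fixes k :: "(int ^ 'd::finite) \<times> nat"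
  shows "(\<integral>\<^sup>+w. ennreal \<bar>w k\<bar> \<partial>white_noise) \<le> 1"
proof -
  let ?N = std_normal_distribution
  interpret N: prob_space ?N by (rule prob_space_std_normal)
  interpret P: product_prob_space "\<lambda>_ :: (int ^ 'd) \<times> nat. ?N" UNIV
    by (intro product_prob_spaceI prob_space_std_normal)
  have comp: "(\<lambda>w. w k) \<in> measurable white_noise ?N" by simp
  have "(\<integral>\<^sup>+w. ennreal \<bar>w k\<bar> \<partial>white_noise) = (\<integral>\<^sup>+x. ennreal \<bar>x\<bar> \<partial>distr white_noise ?N (\<lambda>w. w k))"
    by (rule nn_integral_distr[OF comp, symmetric]) simp
  also have "\<dots> = (\<integral>\<^sup>+x. ennreal \<bar>x\<bar> \<partial>?N)"
    using P.PiM_component[of k] by simp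
  also have "\<dots> \<le> (\<integral>\<^sup>+x. ennreal ((1 + x\<^sup>2) / 2) \<partial>?N)"
  proof (intro nn_integral_mono ennreal_leI)
    fix x :: real
    have "0 \<le> (1 - \<bar>x\<bar>)\<^sup>2" by simp
    also have "\<dots> = 1 + x\<^sup>2 - 2 * \<bar>x\<bar>" by (simp add: power2_diff)
    finally show "\<bar>x\<bar> \<le> (1 + x\<^sup>2) / 2" by simp
  qed
  also have "\<dots> = ennreal (\<integral>x. (1 + x\<^sup>2) / 2 \<partial>?N)"
    using integrable_std_normal_distribution_moment[of 2]
    by (intro nn_integral_eq_integral) auto
  also have "(\<integral>x. (1 + x\<^sup>2) / 2 \<partial>?N) = 1"
    using integrable_std_normal_distribution_moment[of 2] std_normal_distribution_even_moments(1)[of 1]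
      N.prob_space by simp
  finally show ?thesis by simp
qed

lemma nn_integral_noise_layer_le:
  fixes i :: "int ^ 'd::finite" and \<theta> :: real
  defines "r \<equiv> \<bar>\<theta>\<bar> * lattice_degree TYPE('d)"
  shows "(\<integral>\<^sup>+w. ennreal \<bar>noise_layer \<theta> (Suc m) w i\<bar> \<partial>white_noise) \<le> ennreal ((1 + r) * r ^ m / sqrt 2)"
proof -
  let ?B = "l1_ball (Suc m) i"
  have "(\<integral>\<^sup>+w. ennreal \<bar>noise_layer \<theta> (Suc m) w i\<bar> \<partial>white_noise) \<le>
      (\<integral>\<^sup>+w. (\<Sum>j\<in>?B. ennreal \<bar>noise_coeff \<theta> (Suc m) i j\<bar> * ennreal \<bar>w (j, Suc m)\<bar>) \<partial>white_noise)"
  proof (intro nn_integral_mono)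
    fix w :: "(int ^ 'd) \<times> nat \<Rightarrow> real"
    have "\<bar>noise_layer \<theta> (Suc m) w i\<bar> \<le> (\<Sum>j\<in>?B. \<bar>noise_coeff \<theta> (Suc m) i j\<bar> * \<bar>w (j, Suc m)\<bar>)"
      unfolding noise_layer_def abs_mult[symmetric] by (rule sum_abs)
    then show "ennreal \<bar>noise_layer \<theta> (Suc m) w i\<bar> \<le>
        (\<Sum>j\<in>?B. ennreal \<bar>noise_coeff \<theta> (Suc m) i j\<bar> * ennreal \<bar>w (j, Suc m)\<bar>)"
      by (simp add: ennreal_mult[symmetric] sum_ennreal ennreal_leI)
  qed
  also have "\<dots> = (\<Sum>j\<in>?B. ennreal \<bar>noise_coeff \<theta> (Suc m) i j\<bar> * (\<integral>\<^sup>+w. ennreal \<bar>w (j, Suc m)\<bar> \<partial>white_noise))"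
    by (subst nn_integral_sum) (auto intro!: sum.cong nn_integral_cmult)
  also have "\<dots> \<le> (\<Sum>j\<in>?B. ennreal \<bar>noise_coeff \<theta> (Suc m) i j\<bar> * 1)"
    by (intro sum_mono mult_left_mono nn_integral_abs_coordinate_le) simp
  also have "\<dots> = ennreal (\<Sum>j\<in>?B. \<bar>noise_coeff \<theta> (Suc m) i j\<bar>)"
    by (simp add: sum_ennreal)
  also have "\<dots> \<le> ennreal ((1 + r) * r ^ m / sqrt 2)"
    unfolding r_def by (intro ennreal_leI sum_noise_coeff_le)
  finally show ?thesis .
qed

text \<open>First moments suffice: the coefficients of a layer have a geometrically small sum, and a standard
  normal variable has first absolute moment at most \<open>1\<close>.\<close>

lemma nn_integral_noise_tail_le:
  fixes i :: "int ^ 'd::finite" and \<theta> :: real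
  defines "r \<equiv> \<bar>\<theta>\<bar> * lattice_degree TYPE('d)"
  assumes r: "r < 1"
  shows "(\<integral>\<^sup>+w. (\<Sum>m. ennreal \<bar>noise_layer \<theta> (Suc (m + q)) w i\<bar>) \<partial>white_noise) \<le>
    ennreal ((1 + r) * r ^ q / ((1 - r) * sqrt 2))"
proof -
  have r0: "0 \<le> r" by (simp add: r_def)
  have "(\<integral>\<^sup>+w. (\<Sum>m. ennreal \<bar>noise_layer \<theta> (Suc (m + q)) w i\<bar>) \<partial>white_noise) =
      (\<Sum>m. \<integral>\<^sup>+w. ennreal \<bar>noise_layer \<theta> (Suc (m + q)) w i\<bar> \<partial>white_noise)"
    by (rule nn_integral_suminf) simp
  also have "\<dots> \<le> (\<Sum>m. ennreal ((1 + r) * r ^ (m + q) / sqrt 2))"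
    unfolding r_def by (intro suminf_le nn_integral_noise_layer_le) auto
  also have "\<dots> = ennreal ((1 + r) * r ^ q / ((1 - r) * sqrt 2))"
  proof (rule suminf_ennreal_eq)
    show "0 \<le> (1 + r) * r ^ (m + q) / sqrt 2" for m using r0 by simp
    have "(\<lambda>m. (1 + r) * r ^ q / sqrt 2 * r ^ m) sums ((1 + r) * r ^ q / sqrt 2 * (1 / (1 - r)))"
      using r r0 by (intro sums_mult geometric_sums) simp
    then show "(\<lambda>m. (1 + r) * r ^ (m + q) / sqrt 2) sums ((1 + r) * r ^ q / ((1 - r) * sqrt 2))"
      by (simp add: power_add mult_ac)
  qed
  finally show ?thesis .
qed

lemma AE_summable_noise_layers:
  fixes i :: "int ^ 'd::finite"
  assumes "\<bar>\<theta>\<bar> * lattice_degree TYPE('d) < 1"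
  shows "AE w in white_noise. summable (\<lambda>m. \<bar>noise_layer \<theta> m w i\<bar>)"
proof -
  have "(\<integral>\<^sup>+w. (\<Sum>m. ennreal \<bar>noise_layer \<theta> (Suc (m + 0)) w i\<bar>) \<partial>white_noise) < \<infinity>"
    using nn_integral_noise_tail_le[where q = 0 and i = i, OF assms] ennreal_less_top
    unfolding infinity_ennreal_def by (rule le_less_trans)
  then have "(\<integral>\<^sup>+w. (\<Sum>m. ennreal \<bar>noise_layer \<theta> (Suc (m + 0)) w i\<bar>) \<partial>white_noise) \<noteq> \<infinity>"
    by (rule less_imp_neq)
  then have "AE w in white_noise. (\<Sum>m. ennreal \<bar>noise_layer \<theta> (Suc (m + 0)) w i\<bar>) \<noteq> \<infinity>"
    by (rule nn_integral_noteq_infinite[rotated]) measurable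
  then show ?thesis
  proof eventually_elim
    case (elim w)
    then have "summable (\<lambda>m. \<bar>noise_layer \<theta> (Suc m) w i\<bar>)"
      by (intro summable_suminf_not_top) auto
    then show ?case by (subst summable_Suc_iff[symmetric])
  qed
qed

lemma full_field_tail_le:
  fixes i :: "int ^ 'd::finite" and \<theta> :: real
  defines "r \<equiv> \<bar>\<theta>\<bar> * lattice_degree TYPE('d)"
  assumes r: "r < 1"
  shows "integrable white_noise (\<lambda>w. \<bar>full_field \<theta> w i - truncated_field \<theta> (Suc q) w i\<bar>)"
    and "(\<integral>w. \<bar>full_field \<theta> w i - truncated_field \<theta> (Suc q) w i\<bar> \<partial>white_noise) \<le>
      (1 + r) * r ^ q / ((1 - r) * sqrt 2)"
proof -
  let ?f = "\<lambda>w. \<bar>full_field \<theta> w i - truncated_field \<theta> (Suc q) w i\<bar>"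
  let ?b = "(1 + r) * r ^ q / ((1 - r) * sqrt 2)"
  have r0: "0 \<le> r" by (simp add: r_def)
  have "AE w in white_noise. ennreal (?f w) \<le> (\<Sum>m. ennreal \<bar>noise_layer \<theta> (Suc (m + q)) w i\<bar>)"
    using AE_summable_noise_layers[OF r[unfolded r_def], of i]
  proof eventually_elim
    case (elim w)
    have s: "summable (\<lambda>m. \<bar>noise_layer \<theta> (m + Suc q) w i\<bar>)"
      using elim by (subst summable_iff_shift)
    have "full_field \<theta> w i - truncated_field \<theta> (Suc q) w i = (\<Sum>m. noise_layer \<theta> (m + Suc q) w i)"
      unfolding full_field_eq_suminf[OF summable_rabs_cancel[OF elim]] truncated_field_def
      using suminf_minus_initial_segment[OF summable_rabs_cancel[OF elim], of "Suc q"] by simp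
    then have "?f w \<le> (\<Sum>m. \<bar>noise_layer \<theta> (m + Suc q) w i\<bar>)"
      using summable_rabs[OF s] by simp
    then have "ennreal (?f w) \<le> ennreal (\<Sum>m. \<bar>noise_layer \<theta> (m + Suc q) w i\<bar>)"
      by (rule ennreal_leI)
    also have "\<dots> = (\<Sum>m. ennreal \<bar>noise_layer \<theta> (m + Suc q) w i\<bar>)"
      by (rule suminf_ennreal2[symmetric]) (use s in auto)
    finally show ?case by simp
  qed
  then have "(\<integral>\<^sup>+w. ennreal (?f w) \<partial>white_noise) \<le>
      (\<integral>\<^sup>+w. (\<Sum>m. ennreal \<bar>noise_layer \<theta> (Suc (m + q)) w i\<bar>) \<partial>white_noise)"
    by (rule nn_integral_mono_AE)
  also have "\<dots> \<le> ennreal ?b"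
    unfolding r_def by (rule nn_integral_noise_tail_le[OF r[unfolded r_def]])
  finally have le: "(\<integral>\<^sup>+w. ennreal (?f w) \<partial>white_noise) \<le> ennreal ?b" .
  show int: "integrable white_noise ?f"
    using le by (intro integrableI_bounded) (auto intro: le_less_trans)
  have "ennreal (\<integral>w. ?f w \<partial>white_noise) \<le> ennreal ?b"
    using le by (subst nn_integral_eq_integral[symmetric, OF int]) auto
  then show "(\<integral>w. ?f w \<partial>white_noise) \<le> ?b"
    using r r0 by (subst (asm) ennreal_le_iff) auto
qed

lemma jointly_gaussian_full_field:
  fixes \<epsilon> :: real
  defines "\<theta> \<equiv> \<epsilon> / (2 * real CARD('d::finite))"
  assumes r: "\<bar>\<theta>\<bar> * lattice_degree TYPE('d) < 1"
  shows "jointly_gaussian white_noise (\<lambda>(i :: int ^ 'd) w. full_field \<theta> w i) (field_cov \<epsilon>)"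
proof (rule jointly_gaussian_limit[OF jointly_gaussian_truncated_field])
  show "(\<lambda>w. full_field \<theta> w i) \<in> borel_measurable white_noise" for i :: "int ^ 'd"
    by measurable
  show "(\<lambda>n. truncated_cov \<theta> n i j) \<longlonglongrightarrow> field_cov \<epsilon> i j" for i j :: "int ^ 'd"
    unfolding field_cov_def using truncated_cov_limit[OF r, of i j] by (simp add: \<theta>_def)
  show "AE w in white_noise. (\<lambda>n. truncated_field \<theta> n w i) \<longlonglongrightarrow> full_field \<theta> w i" for i :: "int ^ 'd"
    using AE_summable_noise_layers[OF r, of i]
  proof eventually_elim
    case (elim w)
    show ?case
      unfolding truncated_field_def full_field_eq_suminf[OF summable_rabs_cancel[OF elim]]
      by (rule summable_LIMSEQ[OF summable_rabs_cancel[OF elim]])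
  qed
qed

lemma jointly_gaussian_distr:
  fixes F :: "'b \<Rightarrow> int ^ 'd::finite \<Rightarrow> real"
  assumes G: "jointly_gaussian M (\<lambda>i w. F w i) K"
  shows "jointly_gaussian (distr M (config_space UNIV) F) (\<lambda>i \<xi>. \<xi> i) K"
  unfolding jointly_gaussian_def
proof (intro conjI allI impI)
  interpret prob_space M by (rule jointly_gaussianD(1)[OF G])
  have F: "F \<in> measurable M (config_space UNIV)"
    by (rule measurable_into_config_space) (rule jointly_gaussianD(2)[OF G])
  show "prob_space (distr M (config_space UNIV) F)" by (rule prob_space_distr[OF F])
  show "(\<lambda>\<xi>. \<xi> i) \<in> borel_measurable (distr M (config_space UNIV) F)" for i by simp
  fix J :: "(int ^ 'd) set" and a :: "int ^ 'd \<Rightarrow> real" assume J: "finite J"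
  have "(CLINT \<xi>|distr M (config_space UNIV) F. iexp (\<Sum>i\<in>J. a i * \<xi> i)) =
      (CLINT w|M. iexp (\<Sum>i\<in>J. a i * F w i))"
    by (rule integral_distr[OF F]) measurable
  then show "(CLINT \<xi>|distr M (config_space UNIV) F. iexp (\<Sum>i\<in>J. a i * \<xi> i)) =
      of_real (exp (- (\<Sum>i\<in>J. \<Sum>j\<in>J. a i * a j * K i j) / 2))"
    using jointly_gaussianD(3)[OF G J] by (rule trans)
qed

lemma field_cov_commute: "field_cov \<epsilon> i j = field_cov \<epsilon> j i"
  unfolding field_cov_def by (subst path_count_commute) (rule refl)

text \<open>The law of the series satisfies the defining conditions of \<open>gaussian_field\<close>, and a law
  satisfying them is jointly Gaussian with the same covariance, hence equal to it.\<close>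

lemma gaussian_field_eq_distr:
  fixes \<epsilon> :: real
  defines "\<theta> \<equiv> \<epsilon> / (2 * real CARD('d::finite))"
  assumes r: "\<bar>\<theta>\<bar> * lattice_degree TYPE('d) < 1"
  shows "(gaussian_field \<epsilon> :: (int ^ 'd \<Rightarrow> real) measure) = distr white_noise (config_space UNIV) (full_field \<theta>)"
    (is "_ = ?\<mu>")
proof -
  have G: "jointly_gaussian ?\<mu> (\<lambda>i \<xi>. \<xi> i) (field_cov \<epsilon>)"
    unfolding \<theta>_def by (intro jointly_gaussian_distr jointly_gaussian_full_field) (rule r[unfolded \<theta>_def])
  show ?thesis
    unfolding gaussian_field_def
  proof (rule the_equality, intro conjI allI)
    show "sets ?\<mu> = sets (config_space UNIV)" by simp
    show "centered_gaussian_process ?\<mu> (\<lambda>i \<xi>. \<xi> i)"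
      by (rule jointly_gaussian_imp_centered_gaussian_process[OF G])
    show "covariance ?\<mu> (\<lambda>\<xi>. \<xi> i) (\<lambda>\<xi>. \<xi> j) = field_cov \<epsilon> i j" for i j
      by (rule jointly_gaussian_covariance[OF G field_cov_commute])
  next
    fix \<nu> :: "(int ^ 'd \<Rightarrow> real) measure"
    assume \<nu>: "sets \<nu> = sets (config_space UNIV) \<and> centered_gaussian_process \<nu> (\<lambda>i \<xi>. \<xi> i) \<and>
      (\<forall>i j. covariance \<nu> (\<lambda>\<xi>. \<xi> i) (\<lambda>\<xi>. \<xi> j) = field_cov \<epsilon> i j)"
    have "jointly_gaussian \<nu> (\<lambda>i \<xi>. \<xi> i) (field_cov \<epsilon>)"
      by (rule centered_gaussian_process_imp_jointly_gaussian) (use \<nu> in auto)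
    then show "\<nu> = ?\<mu>"
      using G \<nu> by (intro jointly_gaussian_coordinates_unique) auto
  qed
qed

section \<open>Factor of an i.i.d. process and finite-range approximation\<close>

lemma measurable_uncurry:
  "(\<lambda>y (i, j). y i j) \<in> measurable (PiM UNIV (\<lambda>_ :: 'i. PiM UNIV (\<lambda>_ :: 'j. M))) (PiM UNIV (\<lambda>_. M))"
proof (rule measurable_PiM_single')
  fix k :: "'i \<times> 'j"
  show "(\<lambda>y. (case k of (i, j) \<Rightarrow> y i j)) \<in> measurable (PiM UNIV (\<lambda>_ :: 'i. PiM UNIV (\<lambda>_ :: 'j. M))) M"
    using measurable_compose[OF measurable_component_singleton[of "fst k" UNIV "\<lambda>_. PiM UNIV (\<lambda>_. M)"]
        measurable_component_singleton[of "snd k" UNIV "\<lambda>_. M"]]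
    by (simp add: split_beta')
qed (auto simp: space_PiM PiE_def Pi_def)

lemma distr_PiM_uncurry:
  fixes M :: "'b measure"
  assumes M: "prob_space M"
  shows "distr (PiM UNIV (\<lambda>_ :: 'i. PiM UNIV (\<lambda>_ :: 'j. M))) (PiM UNIV (\<lambda>_. M)) (\<lambda>y (i, j). y i j)
    = PiM UNIV (\<lambda>_. M)" (is "distr ?PP ?P ?u = _")
proof -
  interpret M: prob_space M by fact
  let ?R = "PiM UNIV (\<lambda>_ :: 'j. M)"
  interpret R: product_prob_space "\<lambda>_ :: 'j. M" UNIV using M by (intro product_prob_spaceI)
  interpret PP: product_prob_space "\<lambda>_ :: 'i. ?R" UNIV
    by (intro product_prob_spaceI R.prob_space_axioms)
  interpret P: product_prob_space "\<lambda>_ :: 'i \<times> 'j. M" UNIV using M by (intro product_prob_spaceI)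
  note u = measurable_uncurry[where 'i = 'i and 'j = 'j and M = M]
  show ?thesis
  proof (rule P.PiM_eq)
    fix J :: "('i \<times> 'j) set" and F assume J: "finite J" and F: "\<And>k. k \<in> J \<Longrightarrow> F k \<in> sets M"
    define G where "G i j = (if (i, j) \<in> J then F (i, j) else space M)" for i j
    have G: "G i j \<in> sets M" for i j using F by (simp add: G_def)
    let ?I = "fst ` J" and ?L = "snd ` J"
    let ?row = "\<lambda>i. prod_emb UNIV (\<lambda>_. M) ?L (Pi\<^sub>E ?L (G i))"
    have row: "?row i \<in> sets ?R" for i
      using J G by (intro sets_PiM_I) auto
    have pre: "?u -` prod_emb UNIV (\<lambda>_. M) J (Pi\<^sub>E J F) \<inter> space ?PP = prod_emb UNIV (\<lambda>_. ?R) ?I (Pi\<^sub>E ?I ?row)"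
    proof -
      have "(\<forall>k\<in>J. y (fst k) (snd k) \<in> F k) \<longleftrightarrow> (\<forall>i\<in>?I. \<forall>j\<in>?L. y i j \<in> G i j)"
        if "y \<in> space ?PP" for y
      proof -
        have sp: "y i j \<in> space M" for i j
          using that by (auto simp: space_PiM PiE_iff)
        show ?thesis
        proof (intro iffI ballI)
          fix i j assume "\<forall>k\<in>J. y (fst k) (snd k) \<in> F k"
          then show "y i j \<in> G i j" using sp by (force simp: G_def)
        next
          fix k assume "\<forall>i\<in>?I. \<forall>j\<in>?L. y i j \<in> G i j" and k: "k \<in> J"
          then have "y (fst k) (snd k) \<in> G (fst k) (snd k)" by blast
          then show "y (fst k) (snd k) \<in> F k" using k by (simp add: G_def)
        qed
      qed
      then show ?thesis
        by (auto simp: prod_emb_def space_PiM PiE_iff split_beta')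
    qed
    have "emeasure (distr ?PP ?P ?u) (prod_emb UNIV (\<lambda>_. M) J (Pi\<^sub>E J F)) =
        emeasure ?PP (prod_emb UNIV (\<lambda>_. ?R) ?I (Pi\<^sub>E ?I ?row))"
      using J F by (subst emeasure_distr[OF u]) (auto simp: pre intro!: sets_PiM_I)
    also have "\<dots> = (\<Prod>i\<in>?I. emeasure ?R (?row i))"
      using J row by (intro PP.emeasure_PiM_emb) auto
    also have "\<dots> = (\<Prod>i\<in>?I. \<Prod>j\<in>?L. emeasure M (G i j))"
      using J G by (intro prod.cong refl R.emeasure_PiM_emb) auto
    also have "\<dots> = (\<Prod>k\<in>?I \<times> ?L. emeasure M (G (fst k) (snd k)))"
      by (simp add: prod.cartesian_product split_beta')
    also have "\<dots> = (\<Prod>k\<in>J. emeasure M (F k))"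
      using J by (intro prod.mono_neutral_cong_right)
        (auto simp: G_def M.emeasure_space_1 image_iff Bex_def)
    finally show "emeasure (distr ?PP ?P ?u) (prod_emb UNIV (\<lambda>_. M) J (Pi\<^sub>E J F)) = (\<Prod>k\<in>J. emeasure M (F k))" .
  qed simp
qed

lemma noise_layer_translate:
  "noise_layer \<theta> n (\<lambda>(j, m). y (j + a) m) i = noise_layer \<theta> n (\<lambda>(j, m). y j m) (i + a)"
  unfolding noise_layer_def l1_ball_translate[of n i a]
  by (subst sum.reindex) (auto simp: noise_coeff_translate)

text \<open>The source symbol at a site is the whole sequence of noises of that site.
  Equivariance holds at every point and not just almost surely, because the
  series at different sites are translates of one another term by term.\<close>

lemma factor_of_iid_full_field:
  "factor_of_iid (distr white_noise (config_space UNIV) (full_field \<theta>) :: (int ^ 'd::finite \<Rightarrow> real) measure)"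
proof (rule factor_of_iid_any_type)
  let ?N = "PiM UNIV (\<lambda>_ :: nat. std_normal_distribution)"
  let ?PP = "PiM UNIV (\<lambda>_ :: int ^ 'd. ?N)"
  let ?u = "\<lambda>y (i, n). y i n :: real"
  have N: "prob_space ?N" by (intro prob_space_PiM prob_space_std_normal)
  have F: "full_field \<theta> \<in> measurable white_noise (config_space UNIV)"
    by (rule measurable_into_config_space) measurable
  have u: "?u \<in> measurable ?PP white_noise" by (rule measurable_uncurry)
  show "equivariant_factor ?N (\<lambda>y. full_field \<theta> (?u y))
      (distr white_noise (config_space UNIV) (full_field \<theta>) :: (int ^ 'd \<Rightarrow> real) measure)"
    unfolding equivariant_factor_def
  proof (intro conjI allI ballI)
    show "prob_space ?N" by (rule N)
    show "(\<lambda>y. full_field \<theta> (?u y)) \<in> measurable ?PP (config_space UNIV)"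
      by (rule measurable_compose[OF u F])
    show "distr white_noise (config_space UNIV) (full_field \<theta>) =
        distr ?PP (config_space UNIV) (\<lambda>y. full_field \<theta> (?u y))"
      using distr_distr[OF F u] by (simp add: distr_PiM_uncurry[OF prob_space_std_normal] comp_def)
    show "full_field \<theta> (?u (translate a y)) = translate a (full_field \<theta> (?u y))" for a y
      by (simp add: fun_eq_iff full_field_def smooth_part_def translate_def noise_layer_translate)
  qed
qed

text \<open>The layers \<open>0, \<dots>, q\<close> read noise within distance \<open>q\<close>, and balls of radius \<open>q\<close> around sites at
  distance greater than \<open>2 * q\<close> are disjoint.\<close>

lemma l_dependent_truncated_field:
  assumes "2 * q \<le> l"
  shows "l_dependent l (distr white_noise (config_space UNIV) (truncated_field \<theta> (Suc q)))"
proof (rule l_dependent_local_function[where dep = "\<lambda>i. {(j, m). m \<le> q \<and> j \<in> l1_ball m i}"])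
  show "truncated_field \<theta> (Suc q) \<in> measurable white_noise (config_space UNIV)"
    by (rule measurable_into_config_space) measurable
  show "truncated_field \<theta> (Suc q) w i = truncated_field \<theta> (Suc q) w' i"
    if "\<And>k. k \<in> {(j, m). m \<le> q \<and> j \<in> l1_ball m i} \<Longrightarrow> w k = w' k" for w w' i
    using that unfolding truncated_field_def noise_layer_def by (intro sum.cong refl) auto
  show "{(j, m). m \<le> q \<and> j \<in> l1_ball m i} \<inter> {(j, m). m \<le> q \<and> j \<in> l1_ball m i'} = {}"
    if far: "l1_dist i i' > int l" for i i' :: "int ^ 'a"
  proof -
    have False if "m \<le> q" "j \<in> l1_ball m i" "j \<in> l1_ball m i'" for j m
      using that far assms l1_dist_triangle[of i i' j] l1_dist_commute[of j i']
      by (simp add: l1_ball_def)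
    then show ?thesis by auto
  qed
qed

lemma noise_layer_Suc_update:
  "noise_layer \<theta> (Suc m) (w((k, 0) := x)) i = noise_layer \<theta> (Suc m) w i"
  by (simp add: noise_layer_def)

lemma measure_restrict_law_distr:
  assumes F: "F \<in> measurable M (config_space UNIV)" and Q: "Q \<in> sets (config_space \<Lambda>)"
  shows "measure (restrict_law \<Lambda> (distr M (config_space UNIV) F)) Q =
    measure M ({w \<in> space M. restrict (F w) \<Lambda> \<in> Q})"
proof -
  have res: "(\<lambda>\<xi>. restrict \<xi> \<Lambda>) \<in> measurable (config_space UNIV) (config_space \<Lambda>)"
    by (rule measurable_restrict_subset) simp
  have "restrict_law \<Lambda> (distr M (config_space UNIV) F) =
      distr M (config_space \<Lambda>) (\<lambda>w. restrict (F w) \<Lambda>)"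
    unfolding restrict_law_def using distr_distr[OF res F] by (simp add: comp_def)
  then show ?thesis
    using measure_distr[OF measurable_compose[OF F res] Q] by (simp add: vimage_def Int_def conj_commute)
qed

lemma tv_dist_truncated_field_le:
  fixes \<Lambda> :: "(int ^ 'd::finite) set" and \<theta> :: real
  defines "r \<equiv> \<bar>\<theta>\<bar> * lattice_degree TYPE('d)"
  assumes r: "r < 1" and fin: "finite \<Lambda>"
  shows "tv_dist (restrict_law \<Lambda> (distr white_noise (config_space UNIV) (full_field \<theta>)))
      (restrict_law \<Lambda> (distr white_noise (config_space UNIV) (truncated_field \<theta> (Suc q))))
    \<le> real (card \<Lambda>) * ((1 + r) * r ^ q / (2 * (1 - r)))" (is "tv_dist ?M ?M' \<le> _")
  unfolding tv_dist_def
proof (rule cSUP_least)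
  show "sets ?M \<noteq> {}" by auto
  fix Q assume "Q \<in> sets ?M"
  then have Q: "Q \<in> sets (config_space \<Lambda>)" by (simp add: restrict_law_def)
  let ?V = "smooth_part \<theta>" and ?V' = "\<lambda>w i. \<Sum>m<q. noise_layer \<theta> (Suc m) w i"
  have F: "full_field \<theta> \<in> measurable white_noise (config_space UNIV)"
    "truncated_field \<theta> (Suc q) \<in> measurable white_noise (config_space UNIV)"
    by (rule measurable_into_config_space, measurable)+
  have diff: "\<bar>?V w i - ?V' w i\<bar> = \<bar>full_field \<theta> w i - truncated_field \<theta> (Suc q) w i\<bar>" for w i
    by (simp add: full_field_def truncated_field_Suc)
  have tail: "(\<integral>w. \<bar>full_field \<theta> w i - truncated_field \<theta> (Suc q) w i\<bar> \<partial>white_noise)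
      \<le> (1 + r) * r ^ q / ((1 - r) * sqrt 2)" for i :: "int ^ 'd"
    unfolding r_def by (rule full_field_tail_le(2)[OF r[unfolded r_def]])
  have "\<bar>measure white_noise {w. (\<lambda>i\<in>\<Lambda>. 1 / sqrt 2 * w (i, 0) + ?V w i) \<in> Q} -
      measure white_noise {w. (\<lambda>i\<in>\<Lambda>. 1 / sqrt 2 * w (i, 0) + ?V' w i) \<in> Q}\<bar>
      \<le> (\<Sum>i\<in>\<Lambda>. (\<integral>w. \<bar>?V w i - ?V' w i\<bar> \<partial>white_noise) / (2 * (1 / sqrt 2)))"
  proof (rule replace_shift_tv)
    show "inj (\<lambda>i :: int ^ 'd. (i, 0 :: nat))" by (auto simp: inj_on_def)
    show "integrable white_noise (\<lambda>w. \<bar>?V w i - ?V' w i\<bar>)" for i :: "int ^ 'd"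
      unfolding diff by (rule full_field_tail_le(1)[OF r[unfolded r_def]])
    show "?V (w((k, 0) := x)) i = ?V w i" "?V' (w((k, 0) := x)) i = ?V' w i"
      for w and k i :: "int ^ 'd" and x
      by (simp_all only: smooth_part_def noise_layer_Suc_update)
  qed (use fin Q in \<open>auto\<close>)
  also have "\<dots> \<le> (\<Sum>i\<in>\<Lambda>. (1 + r) * r ^ q / ((1 - r) * sqrt 2) / (2 * (1 / sqrt 2)))"
    unfolding diff by (intro sum_mono divide_right_mono tail) simp
  also have "\<dots> = real (card \<Lambda>) * ((1 + r) * r ^ q / (2 * (1 - r)))"
    by simp
  finally show "\<bar>measure ?M Q - measure ?M' Q\<bar> \<le> real (card \<Lambda>) * ((1 + r) * r ^ q / (2 * (1 - r)))"
    unfolding measure_restrict_law_distr[OF F(1) Q] measure_restrict_law_distr[OF F(2) Q]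
    by (simp add: full_field_def[abs_def] truncated_field_Suc[abs_def] space_PiM)
qed

text \<open>The approximation bound carries no multiplicative constant, so for \<open>l = 1\<close>, where only layer \<open>0\<close> is kept, it
  must already be smaller than \<open>1\<close>. The bound \<open>r \<le> 1/9\<close> makes the prefactor at most \<open>5/8\<close> and leaves room to
  absorb it into the rate, as \<open>1/9 \<le> (5/8)\<^sup>2\<close> and \<open>l \<le> 2 * (l div 2) + 1\<close>.\<close>

lemma decay_rate_le:
  fixes r :: real
  assumes r: "0 \<le> r" "r \<le> 1 / 9"
  shows "(1 + r) * r ^ (l div 2) / (2 * (1 - r)) \<le> exp (- ln (8 / 5) * real l)"
proof -
  let ?q = "l div 2"
  have "(1 + r) / (2 * (1 - r)) \<le> 5 / 8" using r by (simp add: divide_le_eq)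
  moreover have "r ^ ?q \<le> ((5 / 8) ^ 2) ^ ?q"
    using r by (intro power_mono) (auto simp: power2_eq_square)
  ultimately have "(1 + r) / (2 * (1 - r)) * r ^ ?q \<le> 5 / 8 * ((5 / 8) ^ 2) ^ ?q"
    using r by (intro mult_mono) auto
  also have "\<dots> = (5 / 8) ^ Suc (2 * ?q)" by (simp add: power_mult)
  also have "\<dots> \<le> (5 / 8) ^ l" by (intro power_decreasing) auto
  also have "\<dots> = exp (- ln (8 / 5) * real l)"
  proof -
    have rate: "exp (- ln (8 / 5 :: real)) = 5 / 8" by (simp add: exp_minus)
    have "(5 / 8 :: real) ^ l = exp (- ln (8 / 5)) ^ l" unfolding rate ..
    also have "\<dots> = exp (- ln (8 / 5) * real l)" by (metis exp_of_nat2_mult mult.commute)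
    finally show ?thesis .
  qed
  finally show ?thesis by simp
qed

theorem theorem1p3:
  shows "\<exists>\<epsilon>0::real. 0 < \<epsilon>0 \<and> \<epsilon>0 < 1 \<and>
    (\<forall>\<epsilon>::real. \<bar>\<epsilon>\<bar> \<le> \<epsilon>0 \<longrightarrow>
      factor_of_iid (gaussian_field \<epsilon> :: (int ^ 'd::finite \<Rightarrow> real) measure) \<and>
      (\<exists>c>0. \<forall>l::nat. \<exists>\<nu> :: (int ^ 'd \<Rightarrow> real) measure.
         l_dependent l \<nu> \<and>
         (\<forall>\<Lambda>. finite \<Lambda> \<longrightarrow>
            tv_dist (restrict_law \<Lambda> (gaussian_field \<epsilon>)) (restrict_law \<Lambda> \<nu>)
              \<le> real (card \<Lambda>) * exp (- c * real l))))"
proof -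
  define D where "D = lattice_degree TYPE('d)"
  \<comment> \<open>As \<open>\<bar>\<theta>\<bar> \<le> \<bar>\<epsilon>\<bar>\<close>, this makes \<open>r = \<bar>\<theta>\<bar> * D\<close> at most \<open>1/9\<close>; adding \<open>1\<close> keeps \<open>\<epsilon>0\<close> below \<open>1\<close> and the denominator positive.\<close>
  define \<epsilon>0 where "\<epsilon>0 = 1 / (9 * (D + 1))"
  have D: "0 \<le> D" by (simp add: D_def)
  have \<epsilon>0: "0 < \<epsilon>0" "\<epsilon>0 < 1" using D by (simp_all add: \<epsilon>0_def)
  have "factor_of_iid (gaussian_field \<epsilon> :: (int ^ 'd \<Rightarrow> real) measure) \<and>
      (\<exists>c>0. \<forall>l::nat. \<exists>\<nu> :: (int ^ 'd \<Rightarrow> real) measure.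
         l_dependent l \<nu> \<and>
         (\<forall>\<Lambda>. finite \<Lambda> \<longrightarrow>
            tv_dist (restrict_law \<Lambda> (gaussian_field \<epsilon>)) (restrict_law \<Lambda> \<nu>)
              \<le> real (card \<Lambda>) * exp (- c * real l)))" if \<epsilon>: "\<bar>\<epsilon>\<bar> \<le> \<epsilon>0" for \<epsilon> :: real
  proof (intro conjI)
    define \<theta> where "\<theta> = \<epsilon> / (2 * real CARD('d))"
    define r where "r = \<bar>\<theta>\<bar> * D"
    have "1 \<le> 2 * real CARD('d)"
      using zero_less_card_finite[where 'a = 'd] by linarith
    then have "\<bar>\<theta>\<bar> \<le> \<bar>\<epsilon>\<bar>"
      using mult_left_mono[of 1 "2 * real CARD('d)" "\<bar>\<epsilon>\<bar>"] by (simp add: \<theta>_def divide_le_eq)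
    then have "r \<le> \<epsilon>0 * D"
      using \<epsilon> D unfolding r_def by (intro mult_right_mono) auto
    also have "\<epsilon>0 * D \<le> 1 / 9" using D by (simp add: \<epsilon>0_def divide_le_eq)
    finally have r: "0 \<le> r" "r \<le> 1 / 9" using D by (simp_all add: r_def)
    have r1: "\<bar>\<theta>\<bar> * lattice_degree TYPE('d) < 1" using r by (simp add: r_def D_def)
    have law: "(gaussian_field \<epsilon> :: (int ^ 'd \<Rightarrow> real) measure) =
        distr white_noise (config_space UNIV) (full_field \<theta>)"
      unfolding \<theta>_def by (rule gaussian_field_eq_distr) (rule r1[unfolded \<theta>_def])
    show "factor_of_iid (gaussian_field \<epsilon> :: (int ^ 'd \<Rightarrow> real) measure)"
      unfolding law by (rule factor_of_iid_full_field)
    show "\<exists>c>0. \<forall>l::nat. \<exists>\<nu> :: (int ^ 'd \<Rightarrow> real) measure.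
         l_dependent l \<nu> \<and>
         (\<forall>\<Lambda>. finite \<Lambda> \<longrightarrow>
            tv_dist (restrict_law \<Lambda> (gaussian_field \<epsilon>)) (restrict_law \<Lambda> \<nu>)
              \<le> real (card \<Lambda>) * exp (- c * real l))"
    proof (intro exI[of _ "ln (8 / 5)"] conjI allI)
      show "0 < ln (8 / 5 :: real)" by simp
      fix l :: nat
      let ?\<nu> = "distr white_noise (config_space UNIV) (truncated_field \<theta> (Suc (l div 2))) :: (int ^ 'd \<Rightarrow> real) measure"
      have "tv_dist (restrict_law \<Lambda> (gaussian_field \<epsilon>)) (restrict_law \<Lambda> ?\<nu>)
          \<le> real (card \<Lambda>) * exp (- ln (8 / 5) * real l)" if "finite \<Lambda>" for \<Lambda>
      proof -
        have "tv_dist (restrict_law \<Lambda> (gaussian_field \<epsilon>)) (restrict_law \<Lambda> ?\<nu>)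
            \<le> real (card \<Lambda>) * ((1 + r) * r ^ (l div 2) / (2 * (1 - r)))"
          unfolding law r_def D_def by (rule tv_dist_truncated_field_le[OF r1 that])
        also have "\<dots> \<le> real (card \<Lambda>) * exp (- ln (8 / 5) * real l)"
          by (intro mult_left_mono decay_rate_le r) simp
        finally show ?thesis .
      qed
      moreover have "l_dependent l ?\<nu>" by (rule l_dependent_truncated_field) simp
      ultimately show "\<exists>\<nu> :: (int ^ 'd \<Rightarrow> real) measure. l_dependent l \<nu> \<and>
         (\<forall>\<Lambda>. finite \<Lambda> \<longrightarrow>
            tv_dist (restrict_law \<Lambda> (gaussian_field \<epsilon>)) (restrict_law \<Lambda> \<nu>)
              \<le> real (card \<Lambda>) * exp (- ln (8 / 5) * real l))" by blast
    qed
  qed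
  then show ?thesis using \<epsilon>0 by blast
qed

end
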